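(* Let $d\in\mathbb{N}$ be fixed, and let $\mathcal P$ and $\mathcal Q$ be two fixed distributions on $\mathbb{R}^d$ having bounded continuous densities, with $\mathcal Q$ also zero-mean and satisfying $\mathbb{E}[\|\tilde Z_1\|_2^d]<+\infty$ for $\tilde Z_1\sim\mathcal Q$. Let $\sigma=\sigma_n>0$, let $X_1,\dots,X_n$ be i.i.d. with law $\mathcal P$, let $Z_i=\sigma\tilde Z_i$ with $\tilde Z_1,\dots,\tilde Z_n$ i.i.d. with law $\mathcal Q$, and let $Y_i=X_{\pi^\star(i)}+Z_i$ for $i\in[n]$, where $\pi^\star$ is uniform on $S_n$. Then, as $n\to+\infty$, $$\inf_{\hat\pi}\mathbb{E}\left[d_H(\hat\pi,\pi^\star)\right]=\Theta\left((n^2\sigma^d)\wedge n\right).$$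
   Context: The $X$'s, the $Z$'s and $\pi^\star$ are mutually independent. $S_n$ is the group of permutations of $[n]=\{1,\dots,n\}$. An estimator $\hat\pi$ is a (measurable) map taking $(X_1,\dots,X_n,Y_1,\dots,Y_n)$ to a permutation in $S_n$; the infimum is over all estimators. $d_H(\hat\pi,\pi^\star)=\sum_{j=1}^n\mathbf 1[\hat\pi(j)\ne\pi^\star(j)]$. $a\wedge b=\min(a,b)$. The constants in $\Theta$ do not depend on $n$ (they may depend on $d,\mathcal P,\mathcal Q$). *)

theory Defs
  imports "HOL-Probability.Probability" "HOL-Combinatorics.Permutations"
begin

definition has_bounded_continuous_density :: "'a::euclidean_space measure \<Rightarrow> bool" where
  "has_bounded_continuous_density P \<longleftrightarrow>
     (\<exists>p :: 'a \<Rightarrow> real. (\<forall>x. 0 \<le> p x) \<and> continuous_on UNIV p \<and> bounded (range p) \<and>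
        P = density lborel (\<lambda>x. ennreal (p x)))"

definition perms :: "nat \<Rightarrow> (nat \<Rightarrow> nat) set" where
  "perms n = {\<pi>. \<pi> permutes {1..n}}"

definition hamming_dist :: "nat \<Rightarrow> (nat \<Rightarrow> nat) \<Rightarrow> (nat \<Rightarrow> nat) \<Rightarrow> nat" where
  "hamming_dist n \<pi> \<tau> = card {j \<in> {1..n}. \<pi> j \<noteq> \<tau> j}"

text \<open>Joint law of the mutually independent data \<open>((X\<^sub>i)\<^sub>i, ((Z\<^sub>i)\<^sub>i, \<pi>))\<close>: the \<open>X\<^sub>i\<close> are i.i.d. with
  law \<open>P\<close>, the unscaled noise variables \<open>Z\<^sub>i\<close> are i.i.d. with law \<open>Q\<close>, and the permutation \<open>\<pi>\<close> is
  uniform.\<close>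

definition data_law ::
  "'a::euclidean_space measure \<Rightarrow> 'a measure \<Rightarrow> nat \<Rightarrow>
     ((nat \<Rightarrow> 'a) \<times> (nat \<Rightarrow> 'a) \<times> (nat \<Rightarrow> nat)) measure" where
  "data_law P Q n =
     (\<Pi>\<^sub>M i\<in>{1..n}. P) \<Otimes>\<^sub>M ((\<Pi>\<^sub>M i\<in>{1..n}. Q) \<Otimes>\<^sub>M uniform_count_measure (perms n))"

definition noisy_obs ::
  "nat \<Rightarrow> real \<Rightarrow> (nat \<Rightarrow> 'a::euclidean_space) \<Rightarrow> (nat \<Rightarrow> 'a) \<Rightarrow> (nat \<Rightarrow> nat) \<Rightarrow> (nat \<Rightarrow> 'a)" where
  "noisy_obs n s X Z \<pi> = (\<lambda>i\<in>{1..n}. X (\<pi> i) + s *\<^sub>R Z i)"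

definition estimators ::
  "nat \<Rightarrow> ((nat \<Rightarrow> 'a::euclidean_space) \<times> (nat \<Rightarrow> 'a) \<Rightarrow> (nat \<Rightarrow> nat)) set" where
  "estimators n =
     ((\<Pi>\<^sub>M i\<in>{1..n}. borel) \<Otimes>\<^sub>M (\<Pi>\<^sub>M i\<in>{1..n}. borel)) \<rightarrow>\<^sub>M count_space (perms n)"

definition risk ::
  "'a::euclidean_space measure \<Rightarrow> 'a measure \<Rightarrow> nat \<Rightarrow> real \<Rightarrow>
     ((nat \<Rightarrow> 'a) \<times> (nat \<Rightarrow> 'a) \<Rightarrow> (nat \<Rightarrow> nat)) \<Rightarrow> real" where
  "risk P Q n s f =
     (\<integral>(X, Z, \<pi>). real (hamming_dist n (f (X, noisy_obs n s X Z \<pi>)) \<pi>) \<partial>data_law P Q n)"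

text \<open>The infimum is over a nonempty set of reals that is bounded below by \<open>0\<close>. Estimators may
  depend on \<open>P\<close>, \<open>Q\<close>, \<open>n\<close> and \<open>s\<close>.\<close>

definition optimal_risk :: "'a::euclidean_space measure \<Rightarrow> 'a measure \<Rightarrow> nat \<Rightarrow> real \<Rightarrow> real" where
  "optimal_risk P Q n s = (INF f \<in> estimators n. risk P Q n s f)"

end

(*
Upper bound: match each Y_i to its nearest X_j as consistently as possible. Two permutations can only
disagree at i if one of them fails to send i to the strict nearest neighbour of Y_i, so the error is at
most twice the number of i for which some other X_j lies within sigma |Z_i| of Y_i. As the density of
the X_j is bounded, each pair (i, j) contributes O(sigma^d E|Z|^d).

Lower bound: call a pair (a, b) isolated if X_a and X_b are within t of each other and no other X_k is
within t of either, where t is of order min(sigma, n^(-1/d)). Composing pi with the transposition of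
a and b changes the conditional law of Y, given X, by a bounded factor on a set of probability bounded
below, while an estimator cannot be right about both permutations at the preimage of a. Hence every
estimator errs on a fixed fraction of the expected number of isolated pairs, which is of order n^2 t^d.
*)
theory Submission
  imports Defs
begin

subsection \<open>Finite products of probability spaces and the risk\<close>

text \<open>The scale t is forced from two sides. A pair at distance t stays free of third points
  only while n t^d is small, since each other point falls near it with probability of order t^d; and
  exchanging the pair is hard to detect only while t is at most of order sigma. The largest t
  allowed by both makes n^2 t^d of order min (n^2 sigma^d, n), so one construction yields both
  regimes. Isolation also turns pairs into errors: no index has two partners, so errors charged to
  different pairs sit at different positions and add up to at most the Hamming distance. The noise
  density may vanish in places, so likelihood ratios are not compared globally. Instead, both
  conditional laws are bounded below by the same multiple of Lebesgue measure on a small ball, found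
  by continuity of the density. The ball scales with sigma, so the common mass is free of sigma. No
  posterior is computed: the prior is uniform, hence composing with a transposition merely
  rearranges the sum over permutations.\<close>

lemma nn_integral_PiM_two:
  assumes M: "\<And>i. sigma_finite_measure (M i)"
    and I: "finite I" "i \<in> I" "j \<in> I" "i \<noteq> j"
    and f: "f \<in> borel_measurable (Pi\<^sub>M I M)"
  shows "(\<integral>\<^sup>+x. f x \<partial>Pi\<^sub>M I M) =
    (\<integral>\<^sup>+w. \<integral>\<^sup>+b. \<integral>\<^sup>+a. f (w(j := b, i := a)) \<partial>M i \<partial>M j \<partial>Pi\<^sub>M (I - {i, j}) M)"
proof -
  interpret sigma_finite_measure "M k" for k by (rule M)
  interpret product_sigma_finite M by standard
  define K where "K = I - {i, j}"
  have K: "finite K" "i \<notin> insert j K" "j \<notin> K" "I = insert i (insert j K)"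
    using I by (auto simp: K_def)
  have f': "f \<in> borel_measurable (Pi\<^sub>M (insert i (insert j K)) M)"
    using f K(4) by simp
  have "(\<integral>\<^sup>+x. f x \<partial>Pi\<^sub>M I M) = (\<integral>\<^sup>+x. \<integral>\<^sup>+a. f (x(i := a)) \<partial>M i \<partial>Pi\<^sub>M (insert j K) M)"
    unfolding K(4) using K f' by (intro product_nn_integral_insert) auto
  also have "\<dots> = (\<integral>\<^sup>+w. \<integral>\<^sup>+b. \<integral>\<^sup>+a. f (w(j := b, i := a)) \<partial>M i \<partial>M j \<partial>Pi\<^sub>M K M)"
  proof (rule product_nn_integral_insert)
    have "(\<lambda>(x, a). f (x(i := a))) \<in> borel_measurable (Pi\<^sub>M (insert j K) M \<Otimes>\<^sub>M M i)"
      using measurable_compose[OF measurable_add_dim f'] by (simp add: split_beta')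
    then show "(\<lambda>x. \<integral>\<^sup>+a. f (x(i := a)) \<partial>M i) \<in> borel_measurable (Pi\<^sub>M (insert j K) M)"
      by (rule borel_measurable_nn_integral)
  qed (use K in auto)
  finally show ?thesis by (simp add: K_def)
qed

lemma nn_integral_PiM_pair_marginal:
  assumes M: "\<And>i. prob_space (M i)"
    and I: "finite I" "i \<in> I" "j \<in> I" "i \<noteq> j"
    and g[measurable]: "g \<in> borel_measurable (M i \<Otimes>\<^sub>M M j)"
  shows "(\<integral>\<^sup>+x. g (x i, x j) \<partial>Pi\<^sub>M I M) = (\<integral>\<^sup>+b. \<integral>\<^sup>+a. g (a, b) \<partial>M i \<partial>M j)"
proof -
  interpret prob_space "M k" for k by (rule M)
  interpret R: prob_space "Pi\<^sub>M (I - {i, j}) M" by (intro prob_space_PiM M)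
  have [measurable]: "(\<lambda>x. x i) \<in> measurable (Pi\<^sub>M I M) (M i)" "(\<lambda>x. x j) \<in> measurable (Pi\<^sub>M I M) (M j)"
    using I by (auto intro: measurable_component_singleton)
  show ?thesis
    using I by (subst nn_integral_PiM_two[where i = i and j = j])
      (auto simp: R.emeasure_space_1 intro: sigma_finite_measure_axioms)
qed

lemma nn_integral_PiM_marginal:
  assumes M: "\<And>i. prob_space (M i)"
    and I: "i \<in> I" and g[measurable]: "g \<in> borel_measurable (M i)"
  shows "(\<integral>\<^sup>+x. g (x i) \<partial>Pi\<^sub>M I M) = (\<integral>\<^sup>+a. g a \<partial>M i)"
proof -
  have "(\<integral>\<^sup>+a. g a \<partial>M i) = (\<integral>\<^sup>+a. g a \<partial>distr (Pi\<^sub>M I M) (M i) (\<lambda>\<omega>. \<omega> i))"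
    using distr_PiM_component[of I M i] M I by simp
  also have "\<dots> = (\<integral>\<^sup>+x. g (x i) \<partial>Pi\<^sub>M I M)"
    using I by (intro nn_integral_distr measurable_component_singleton) auto
  finally show ?thesis by simp
qed

lemma perms_iff: "\<pi> \<in> perms n \<longleftrightarrow> \<pi> permutes {1..n}"
  by (simp add: perms_def)

lemma finite_perms [simp]: "finite (perms n)"
  by (simp add: perms_def finite_permutations)

lemma card_perms [simp]: "card (perms n) = fact n"
  by (simp add: perms_def card_permutations)

lemma perms_nonempty [simp]: "perms n \<noteq> {}"
  using permutes_id[of "{1..n}"] unfolding perms_def by blast

lemma hamming_dist_le: "hamming_dist n \<pi> \<tau> \<le> n"
  unfolding hamming_dist_def
  by (rule order_trans[OF card_mono[of "{1..n}"]]) auto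

lemma nn_integral_uniform_count_measure:
  assumes "finite A"
  shows "(\<integral>\<^sup>+x. f x \<partial>uniform_count_measure A) = (\<Sum>x\<in>A. ennreal (1 / card A) * f x)"
  using assms by (simp add: uniform_count_measure_def nn_integral_point_measure_finite)

section \<open>The shuffled model: measurability, and the risk as an average over
  permutations\<close>

locale shuffled_observations =
  fixes P Q :: "'a::euclidean_space measure" and n :: nat and s :: real
  assumes P: "prob_space P" and Q: "prob_space Q"
    and sets_P: "sets P = sets borel" and sets_Q: "sets Q = sets borel"
begin

abbreviation "PX \<equiv> (\<Pi>\<^sub>M i\<in>{1..n}. P)"
abbreviation "PZ \<equiv> (\<Pi>\<^sub>M i\<in>{1..n}. Q)"

lemma sets_PX [measurable_cong]: "sets PX = sets (\<Pi>\<^sub>M i\<in>{1..n}. borel)"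
  by (intro sets_PiM_cong) (auto simp: sets_P)

lemma sets_PZ [measurable_cong]: "sets PZ = sets (\<Pi>\<^sub>M i\<in>{1..n}. borel)"
  by (intro sets_PiM_cong) (auto simp: sets_Q)

text \<open>The permutation is held fixed, so that observation \<open>i\<close> reads one coordinate
  of \<open>X\<close>; it is a coordinate of the product space because \<pi> maps the index set into
  itself.\<close>

lemma measurable_noisy_obs:
  assumes "\<pi> \<in> perms n" "X \<in> measurable M (\<Pi>\<^sub>M i\<in>{1..n}. borel)"
    "Z \<in> measurable M (\<Pi>\<^sub>M i\<in>{1..n}. borel)"
  shows "(\<lambda>w. noisy_obs n s (X w) (Z w) \<pi>) \<in> measurable M (\<Pi>\<^sub>M i\<in>{1..n}. borel)"
proof -
  have \<pi>: "\<pi> i \<in> {1..n}" if "i \<in> {1..n}" for i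
    using assms(1) that permutes_in_image unfolding perms_def by fastforce
  show ?thesis
    unfolding noisy_obs_def
  proof (rule measurable_restrict)
    fix i assume i: "i \<in> {1..n}"
    have [measurable]: "(\<lambda>w. X w (\<pi> i)) \<in> borel_measurable M"
      by (rule measurable_compose[OF assms(2) measurable_component_singleton[OF \<pi>[OF i]]])
    have [measurable]: "(\<lambda>w. Z w i) \<in> borel_measurable M"
      by (rule measurable_compose[OF assms(3) measurable_component_singleton[OF i]])
    show "(\<lambda>w. X w (\<pi> i) + s *\<^sub>R Z w i) \<in> borel_measurable M"
      by measurable
  qed
qed

lemma estimate_measurable:
  assumes f: "f \<in> estimators n" and \<pi>: "\<pi> \<in> perms n"
    and X: "X \<in> measurable M (\<Pi>\<^sub>M i\<in>{1..n}. borel)"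
    and Z: "Z \<in> measurable M (\<Pi>\<^sub>M i\<in>{1..n}. borel)"
  shows "(\<lambda>w. f (X w, noisy_obs n s (X w) (Z w) \<pi>)) \<in> measurable M (count_space (perms n))"
proof -
  have [measurable]: "f \<in> (\<Pi>\<^sub>M i\<in>{1..n}. borel) \<Otimes>\<^sub>M (\<Pi>\<^sub>M i\<in>{1..n}. borel) \<rightarrow>\<^sub>M count_space (perms n)"
    using f by (simp add: estimators_def)
  note [measurable] = X Z measurable_noisy_obs[OF \<pi> X Z]
  show ?thesis by measurable
qed

lemma prob_space_data_law: "prob_space (data_law P Q n)"
  unfolding data_law_def
  by (intro prob_space_pair prob_space_PiM P Q prob_space_uniform_count_measure) auto

lemma data_loss_measurable:
  assumes f: "f \<in> estimators n"
  shows "(\<lambda>(X, Z, \<pi>). real (hamming_dist n (f (X, noisy_obs n s X Z \<pi>)) \<pi>)) \<in> borel_measurable (data_law P Q n)"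
proof -
  have "(\<lambda>w. real (hamming_dist n (f (fst w, noisy_obs n s (fst w) (fst (snd w)) (snd (snd w)))) (snd (snd w))))
     \<in> borel_measurable (data_law P Q n)"
  \<comment> \<open>The permutation takes finitely many values, so measurability may be checked with
    \<pi> frozen.\<close>
  proof (rule measurable_compose_countable'[where I = "perms n" and g = "\<lambda>w. snd (snd w)"])
    fix \<pi> assume "\<pi> \<in> perms n"
    note this[measurable]
    have m: "(\<lambda>w. f (fst w, noisy_obs n s (fst w) (fst (snd w)) \<pi>))
        \<in> measurable (data_law P Q n) (count_space (perms n))"
      unfolding data_law_def by (intro estimate_measurable f \<open>\<pi> \<in> perms n\<close>) measurable
    show "(\<lambda>w. real (hamming_dist n (f (fst w, noisy_obs n s (fst w) (fst (snd w)) \<pi>)) \<pi>))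
        \<in> borel_measurable (data_law P Q n)"
      by (rule measurable_compose[OF m]) simp
  next
    show "(\<lambda>w. snd (snd w)) \<in> measurable (data_law P Q n) (count_space (perms n))"
      unfolding data_law_def by measurable
  qed (simp add: countable_finite)
  then show ?thesis by (simp add: split_beta')
qed

lemma data_loss_integrable:
  assumes f: "f \<in> estimators n"
  shows "integrable (data_law P Q n) (\<lambda>(X, Z, \<pi>). real (hamming_dist n (f (X, noisy_obs n s X Z \<pi>)) \<pi>))"
proof -
  interpret prob_space "data_law P Q n" by (rule prob_space_data_law)
  show ?thesis
    by (rule integrable_const_bound[where B = "real n"])
      (auto simp: hamming_dist_le data_loss_measurable[OF f])
qed

lemma risk_nonneg: "0 \<le> risk P Q n s f"
  unfolding risk_def by (rule integral_nonneg_AE) auto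

lemma risk_le_card:
  assumes "f \<in> estimators n"
  shows "risk P Q n s f \<le> n"
proof -
  interpret prob_space "data_law P Q n" by (rule prob_space_data_law)
  show ?thesis
    unfolding risk_def
    by (rule integral_le_const[OF data_loss_integrable[OF assms]]) (auto simp: hamming_dist_le)
qed

lemma loss_measurable:
  assumes f: "f \<in> estimators n" and \<pi>: "\<pi> \<in> perms n"
  shows "(\<lambda>w. of_nat (hamming_dist n (f (fst w, noisy_obs n s (fst w) (snd w) \<pi>)) \<pi>) :: ennreal)
    \<in> borel_measurable (PX \<Otimes>\<^sub>M PZ)"
proof -
  have "(\<lambda>w. f (fst w, noisy_obs n s (fst w) (snd w) \<pi>)) \<in> measurable (PX \<Otimes>\<^sub>M PZ) (count_space (perms n))"
    by (intro estimate_measurable f \<pi>) measurable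
  then show ?thesis
    by (rule measurable_compose) simp
qed

text \<open>Both bounds argue for one fixed permutation at a time, with nonnegative integrals, for
  which exchanging integrals needs measurability only. The integral over \<open>X\<close> is kept
  outside that over \<open>Z\<close> because the lower bound is proved conditionally on
  \<open>X\<close>.\<close>

lemma ennreal_risk:
  assumes f: "f \<in> estimators n"
  shows "ennreal (risk P Q n s f) = (\<Sum>\<pi>\<in>perms n. ennreal (1 / fact n) *
    (\<integral>\<^sup>+X. \<integral>\<^sup>+Z. of_nat (hamming_dist n (f (X, noisy_obs n s X Z \<pi>)) \<pi>) \<partial>PZ \<partial>PX))"
proof -
  let ?U = "uniform_count_measure (perms n)"
  let ?h = "\<lambda>X Z \<pi>. real (hamming_dist n (f (X, noisy_obs n s X Z \<pi>)) \<pi>)"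
  interpret U: prob_space ?U by (intro prob_space_uniform_count_measure) auto
  interpret Z: prob_space PZ by (intro prob_space_PiM Q)
  interpret ZU: pair_sigma_finite PZ ?U by standard
  have meas: "(\<lambda>(X, Z, \<pi>). ennreal (?h X Z \<pi>)) \<in> borel_measurable (PX \<Otimes>\<^sub>M (PZ \<Otimes>\<^sub>M ?U))"
    using data_loss_measurable[OF f] unfolding data_law_def
    by (simp add: split_beta')
  have "ennreal (risk P Q n s f) = (\<integral>\<^sup>+(X, Z, \<pi>). ennreal (?h X Z \<pi>) \<partial>data_law P Q n)"
    unfolding risk_def
    by (subst nn_integral_eq_integral[symmetric, OF data_loss_integrable[OF f]]) (auto simp: split_beta')
  also have "\<dots> = (\<integral>\<^sup>+X. \<integral>\<^sup>+(Z, \<pi>). ennreal (?h X Z \<pi>) \<partial>(PZ \<Otimes>\<^sub>M ?U) \<partial>PX)"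
    unfolding data_law_def by (subst ZU.nn_integral_fst[symmetric, OF meas]) simp
  also have "\<dots> = (\<integral>\<^sup>+X. \<integral>\<^sup>+Z. \<integral>\<^sup>+\<pi>. ennreal (?h X Z \<pi>) \<partial>?U \<partial>PZ \<partial>PX)"
  proof (rule nn_integral_cong)
    fix X assume "X \<in> space PX"
    then have "(\<lambda>(Z, \<pi>). ennreal (?h X Z \<pi>)) \<in> borel_measurable (PZ \<Otimes>\<^sub>M ?U)"
      using measurable_compose[OF measurable_Pair1' meas] by simp
    then show "(\<integral>\<^sup>+(Z, \<pi>). ennreal (?h X Z \<pi>) \<partial>(PZ \<Otimes>\<^sub>M ?U)) = (\<integral>\<^sup>+Z. \<integral>\<^sup>+\<pi>. ennreal (?h X Z \<pi>) \<partial>?U \<partial>PZ)"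
      by (subst U.nn_integral_fst[symmetric]) auto
  qed
  also have "\<dots> = (\<integral>\<^sup>+X. \<integral>\<^sup>+Z. (\<Sum>\<pi>\<in>perms n. ennreal (1 / fact n) * of_nat (hamming_dist n (f (X, noisy_obs n s X Z \<pi>)) \<pi>)) \<partial>PZ \<partial>PX)"
    by (simp add: nn_integral_uniform_count_measure ennreal_of_nat_eq_real_of_nat)
  also have "\<dots> = (\<Sum>\<pi>\<in>perms n. ennreal (1 / fact n) *
    (\<integral>\<^sup>+X. \<integral>\<^sup>+Z. of_nat (hamming_dist n (f (X, noisy_obs n s X Z \<pi>)) \<pi>) \<partial>PZ \<partial>PX))"
  proof -
    note g = loss_measurable[OF f]
    let ?g = "\<lambda>\<pi> w. of_nat (hamming_dist n (f (fst w, noisy_obs n s (fst w) (snd w) \<pi>)) \<pi>) :: ennreal"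
    have "(\<integral>\<^sup>+X. \<integral>\<^sup>+Z. (\<Sum>\<pi>\<in>perms n. ennreal (1 / fact n) * ?g \<pi> (X, Z)) \<partial>PZ \<partial>PX) =
      (\<integral>\<^sup>+w. (\<Sum>\<pi>\<in>perms n. ennreal (1 / fact n) * ?g \<pi> w) \<partial>(PX \<Otimes>\<^sub>M PZ))"
      by (intro Z.nn_integral_fst borel_measurable_sum borel_measurable_times_ennreal borel_measurable_const g)
    also have "\<dots> = (\<Sum>\<pi>\<in>perms n. ennreal (1 / fact n) * (\<integral>\<^sup>+w. ?g \<pi> w \<partial>(PX \<Otimes>\<^sub>M PZ)))"
      by (subst nn_integral_sum) (intro borel_measurable_times_ennreal g borel_measurable_const sum.cong refl nn_integral_cmult; assumption)+
    also have "\<dots> = (\<Sum>\<pi>\<in>perms n. ennreal (1 / fact n) * (\<integral>\<^sup>+X. \<integral>\<^sup>+Z. ?g \<pi> (X, Z) \<partial>PZ \<partial>PX))"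
      by (intro sum.cong arg_cong2[where f = "(*)"] refl Z.nn_integral_fst[symmetric] g)
    finally show ?thesis by simp
  qed
  finally show ?thesis .
qed

end

subsection \<open>Lower bound by exchanging two values of the permutation\<close>

lemma nn_integral_lborel_affine:
  fixes c :: "'a::euclidean_space"
  assumes [measurable]: "f \<in> borel_measurable borel" and "s \<noteq> 0"
  shows "(\<integral>\<^sup>+x. f x \<partial>lborel) = ennreal (\<bar>s\<bar> ^ DIM('a)) * (\<integral>\<^sup>+x. f (c + s *\<^sub>R x) \<partial>lborel)"
  by (subst lborel_affine[OF assms(2), of c])
    (simp add: nn_integral_density nn_integral_distr nn_integral_cmult)

text \<open>If z has density q, then c + s z has density q((y - c) / s) / s^d at y. For y in the
  ball around u + s z0, the vector s (z - z0) is a difference of two vectors of length at most r s,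
  so z lies within 2 r of z0, where q is at least \<delta>. The ball is built from u and not from c,
  so that different centres near u share one minorant.\<close>

lemma nn_integral_affine_density_ge:
  fixes q :: "'a::euclidean_space \<Rightarrow> real"
  assumes q[measurable]: "q \<in> borel_measurable borel"
    and s: "0 < s" and \<delta>: "0 \<le> \<delta>" "\<And>z. z \<in> cball z0 (2 * r) \<Longrightarrow> \<delta> \<le> q z"
    and c: "dist c u \<le> r * s" and h[measurable]: "h \<in> borel_measurable borel"
  shows "ennreal (\<delta> / s ^ DIM('a)) * (\<integral>\<^sup>+y. indicator (cball (u + s *\<^sub>R z0) (r * s)) y * h y \<partial>lborel)
    \<le> (\<integral>\<^sup>+z. h (c + s *\<^sub>R z) \<partial>density lborel (\<lambda>x. ennreal (q x)))"
proof -
  let ?B = "cball (u + s *\<^sub>R z0) (r * s)"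
  have [measurable]: "?B \<in> sets borel" by simp
  have "ennreal (\<delta> / s ^ DIM('a)) * (\<integral>\<^sup>+y. indicator ?B y * h y \<partial>lborel) =
    ennreal \<delta> * (\<integral>\<^sup>+z. indicator ?B (c + s *\<^sub>R z) * h (c + s *\<^sub>R z) \<partial>lborel)"
    using s \<delta>(1)
    by (subst nn_integral_lborel_affine[where s = s and c = c])
      (auto simp: mult.assoc[symmetric] ennreal_mult[symmetric])
  also have "\<dots> = (\<integral>\<^sup>+z. ennreal \<delta> * (indicator ?B (c + s *\<^sub>R z) * h (c + s *\<^sub>R z)) \<partial>lborel)"
    by (simp add: nn_integral_cmult)
  also have "\<dots> \<le> (\<integral>\<^sup>+z. ennreal (q z) * h (c + s *\<^sub>R z) \<partial>lborel)"
  proof (rule nn_integral_mono)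
    fix z
    show "ennreal \<delta> * (indicator ?B (c + s *\<^sub>R z) * h (c + s *\<^sub>R z)) \<le> ennreal (q z) * h (c + s *\<^sub>R z)"
    proof (cases "c + s *\<^sub>R z \<in> ?B")
      case True
      have "s * dist z0 z = norm (s *\<^sub>R (z - z0))"
        using s by (simp add: dist_norm norm_minus_commute)
      also have "\<dots> = norm ((c + s *\<^sub>R z - (u + s *\<^sub>R z0)) - (c - u))"
        by (simp add: algebra_simps)
      also have "\<dots> \<le> norm (c + s *\<^sub>R z - (u + s *\<^sub>R z0)) + norm (c - u)"
        by (rule norm_triangle_ineq4)
      also have "\<dots> \<le> r * s + r * s"
        using True c by (simp add: dist_norm norm_minus_commute)
      finally have "s * dist z0 z \<le> s * (2 * r)"
        by (simp add: algebra_simps)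
      then have "z \<in> cball z0 (2 * r)"
        using s by simp
      then have "\<delta> \<le> q z"
        by (rule \<delta>(2))
      then show ?thesis
        using True by (simp add: mult_right_mono ennreal_leI del: mem_cball)
    qed simp
  qed
  also have "\<dots> = (\<integral>\<^sup>+z. h (c + s *\<^sub>R z) \<partial>density lborel (\<lambda>x. ennreal (q x)))"
    by (simp add: nn_integral_density)
  finally show ?thesis .
qed

lemma nn_integral_affine_density_ge2:
  fixes q :: "'a::euclidean_space \<Rightarrow> real"
  assumes q[measurable]: "q \<in> borel_measurable borel"
    and s: "0 < s" and \<delta>: "0 \<le> \<delta>" "\<And>z. z \<in> cball z0 (2 * r) \<Longrightarrow> \<delta> \<le> q z"
    and c: "dist c u \<le> r * s" and c': "dist c' u \<le> r * s"
    and H[measurable]: "H \<in> borel_measurable (borel \<Otimes>\<^sub>M borel)"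
  defines "Q \<equiv> density lborel (\<lambda>x. ennreal (q x))"
    and "B \<equiv> cball (u + s *\<^sub>R z0) (r * s)" and "k \<equiv> ennreal (\<delta> / s ^ DIM('a))"
  shows "k * (\<integral>\<^sup>+y'. indicator B y' * (k * (\<integral>\<^sup>+y. indicator B y * H (y, y') \<partial>lborel)) \<partial>lborel)
    \<le> (\<integral>\<^sup>+z'. \<integral>\<^sup>+z. H (c + s *\<^sub>R z, c' + s *\<^sub>R z') \<partial>Q \<partial>Q)"
proof -
  have [measurable]: "B \<in> sets borel" by (simp add: B_def)
  have "(\<lambda>y'. k * (\<integral>\<^sup>+y. indicator B y * H (y, y') \<partial>lborel)) \<in> borel_measurable borel"
    by measurable
  from nn_integral_affine_density_ge[OF q s \<delta> c' this]
  have "k * (\<integral>\<^sup>+y'. indicator B y' * (k * (\<integral>\<^sup>+y. indicator B y * H (y, y') \<partial>lborel)) \<partial>lborel)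
    \<le> (\<integral>\<^sup>+z'. k * (\<integral>\<^sup>+y. indicator B y * H (y, c' + s *\<^sub>R z') \<partial>lborel) \<partial>Q)"
    unfolding k_def B_def Q_def by simp
  also have "\<dots> \<le> (\<integral>\<^sup>+z'. \<integral>\<^sup>+z. H (c + s *\<^sub>R z, c' + s *\<^sub>R z') \<partial>Q \<partial>Q)"
    unfolding k_def B_def Q_def
    by (intro nn_integral_mono nn_integral_affine_density_ge[OF q s \<delta> c]) auto
  finally show ?thesis .
qed

text \<open>A two-point argument: the laws of the noisy pair with centres (c, c') and (c', c) both
  dominate the same multiple of Lebesgue measure on B x B, where B is a ball of radius r s. Since H
  + H' is at least 1, the two integrals together are at least the mass of this common minorant. The
  powers of s cancel in that mass.\<close>

lemma nn_integral_affine_density_swap: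
  fixes q :: "'a::euclidean_space \<Rightarrow> real"
  assumes q[measurable]: "q \<in> borel_measurable borel"
    and s: "0 < s" and \<delta>: "0 \<le> \<delta>" "\<And>z. z \<in> cball z0 (2 * r) \<Longrightarrow> \<delta> \<le> q z"
    and c: "dist c c' \<le> r * s"
    and H[measurable]: "H \<in> borel_measurable (borel \<Otimes>\<^sub>M borel)"
    and H'[measurable]: "H' \<in> borel_measurable (borel \<Otimes>\<^sub>M borel)"
    and HH': "\<And>y. 1 \<le> H y + H' y"
  defines "Q \<equiv> density lborel (\<lambda>x. ennreal (q x))"
  shows "ennreal ((\<delta> * unit_ball_vol DIM('a) * r ^ DIM('a))\<^sup>2)
    \<le> (\<integral>\<^sup>+z'. \<integral>\<^sup>+z. H (c + s *\<^sub>R z, c' + s *\<^sub>R z') \<partial>Q \<partial>Q) +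
       (\<integral>\<^sup>+z'. \<integral>\<^sup>+z. H' (c' + s *\<^sub>R z, c + s *\<^sub>R z') \<partial>Q \<partial>Q)"
proof -
  define B where "B = cball (c + s *\<^sub>R z0) (r * s)"
  define k where "k = ennreal (\<delta> / s ^ DIM('a))"
  define J where "J F = k * (\<integral>\<^sup>+y'. indicator B y' * (k * (\<integral>\<^sup>+y. indicator B y * F (y, y') \<partial>lborel)) \<partial>lborel)"
    for F :: "'a \<times> 'a \<Rightarrow> ennreal"
  have [measurable]: "B \<in> sets borel" by (simp add: B_def)
  \<comment> \<open>The sign of \<open>r\<close> is not assumed; it follows because a distance is
    bounded by \<open>r * s\<close>.\<close>
  have "0 \<le> r * s" using c order_trans[OF zero_le_dist] by blast
  then have r: "0 \<le> r" using s by (simp add: zero_le_mult_iff)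
  have B: "k * emeasure lborel B = ennreal (\<delta> * unit_ball_vol DIM('a) * r ^ DIM('a))"
    using s \<delta>(1) r unfolding k_def B_def
    by (simp add: emeasure_cball ennreal_mult[symmetric] power_mult_distrib)
  have "ennreal ((\<delta> * unit_ball_vol DIM('a) * r ^ DIM('a))\<^sup>2) = (k * emeasure lborel B) * (k * emeasure lborel B)"
    unfolding B using \<delta>(1) r by (simp add: ennreal_mult[symmetric] power2_eq_square)
  also have "\<dots> = J (\<lambda>_. 1)"
    unfolding J_def by (simp add: nn_integral_multc nn_integral_cmult ac_simps)
  also have "\<dots> \<le> J (\<lambda>y. H y + H' y)"
    unfolding J_def by (intro mult_left_mono nn_integral_mono HH') auto
  also have "\<dots> = J H + J H'"
    unfolding J_def by (simp add: distrib_left nn_integral_add)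
  also have "\<dots> \<le> (\<integral>\<^sup>+z'. \<integral>\<^sup>+z. H (c + s *\<^sub>R z, c' + s *\<^sub>R z') \<partial>Q \<partial>Q) +
       (\<integral>\<^sup>+z'. \<integral>\<^sup>+z. H' (c' + s *\<^sub>R z, c + s *\<^sub>R z') \<partial>Q \<partial>Q)"
    unfolding J_def Q_def B_def k_def using c \<open>0 \<le> r * s\<close>
    by (intro add_mono nn_integral_affine_density_ge2[OF q s \<delta>]) (auto simp: dist_commute)
  finally show ?thesis .
qed

section \<open>Exchanging two values of the permutation, conditionally on the points\<close>

context shuffled_observations
begin

lemma noisy_obs_update2:
  assumes \<pi>: "\<pi> \<in> perms n" and ij: "i \<in> {1..n}" "j \<in> {1..n}" "i \<noteq> j"
  shows "noisy_obs n s X (w(j := b, i := a)) \<pi> =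
    (noisy_obs n s X w \<pi>)(j := X (\<pi> j) + s *\<^sub>R b, i := X (\<pi> i) + s *\<^sub>R a)"
  using ij by (auto simp: noisy_obs_def fun_eq_iff)

text \<open>By injectivity of \<pi>, only the observations at \<open>i\<close> and \<open>j\<close>
  feel the transposition. All other observations agree with those under \<pi>, so their noise can be
  frozen when the two permutations are compared.\<close>

lemma noisy_obs_transpose_update2:
  assumes \<pi>: "\<pi> \<in> perms n" and ij: "i \<in> {1..n}" "j \<in> {1..n}" "i \<noteq> j"
  shows "noisy_obs n s X (w(j := b, i := a)) (Transposition.transpose (\<pi> i) (\<pi> j) \<circ> \<pi>) =
    (noisy_obs n s X w \<pi>)(j := X (\<pi> i) + s *\<^sub>R b, i := X (\<pi> j) + s *\<^sub>R a)"
proof -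
  have "inj \<pi>"
    using \<pi> by (auto simp: perms_iff intro: permutes_inj)
  then have "\<pi> k \<noteq> \<pi> i" "\<pi> k \<noteq> \<pi> j" if "k \<noteq> i" "k \<noteq> j" for k
    using that by (auto dest: injD)
  then show ?thesis
    using ij by (auto simp: noisy_obs_def fun_eq_iff)
qed

lemma transpose_perms:
  assumes "\<pi> \<in> perms n" "a \<in> {1..n}" "b \<in> {1..n}"
  shows "Transposition.transpose a b \<circ> \<pi> \<in> perms n"
  using assms by (auto simp: perms_iff intro!: permutes_compose permutes_swap_id)

text \<open>With the noise outside \<open>i\<close> and \<open>j\<close> frozen, \<open>F\<close>
  and \<open>F'\<close> become functions of two noisy points whose centres are exchanged by the
  transposition, and the two-point bound applies for each frozen value. The intended
  \<open>F\<close> and \<open>F'\<close> are error indicators that cannot vanish together, because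
  one estimate cannot take two values at \<open>i\<close>.\<close>

lemma swap_lower_bound:
  fixes q :: "'a \<Rightarrow> real"
  assumes Q_eq: "Q = density lborel (\<lambda>x. ennreal (q x))"
    and q: "q \<in> borel_measurable borel"
    and s: "0 < s" and \<delta>: "0 \<le> \<delta>" "\<And>z. z \<in> cball z0 (2 * r) \<Longrightarrow> \<delta> \<le> q z"
    and \<pi>: "\<pi> \<in> perms n" and ij: "i \<in> {1..n}" "j \<in> {1..n}" "i \<noteq> j"
    and X: "X \<in> space PX" and close: "dist (X (\<pi> i)) (X (\<pi> j)) \<le> r * s"
    and F: "F \<in> borel_measurable (\<Pi>\<^sub>M i\<in>{1..n}. borel)"
    and F': "F' \<in> borel_measurable (\<Pi>\<^sub>M i\<in>{1..n}. borel)"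
    and FF': "\<And>y. 1 \<le> F y + F' y"
  shows "ennreal ((\<delta> * unit_ball_vol DIM('a) * r ^ DIM('a))\<^sup>2) \<le>
    (\<integral>\<^sup>+Z. F (noisy_obs n s X Z \<pi>) \<partial>PZ) +
    (\<integral>\<^sup>+Z. F' (noisy_obs n s X Z (Transposition.transpose (\<pi> i) (\<pi> j) \<circ> \<pi>)) \<partial>PZ)"
proof -
  let ?\<kappa> = "ennreal ((\<delta> * unit_ball_vol DIM('a) * r ^ DIM('a))\<^sup>2)"
  let ?\<pi>' = "Transposition.transpose (\<pi> i) (\<pi> j) \<circ> \<pi>"
  let ?N = "\<lambda>Z. noisy_obs n s X Z \<pi>" and ?N' = "\<lambda>Z. noisy_obs n s X Z ?\<pi>'"
  let ?K = "{1..n} - {i, j}"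
  let ?c = "X (\<pi> i)" and ?c' = "X (\<pi> j)"
  interpret Q: prob_space Q by (rule Q)
  interpret K: prob_space "\<Pi>\<^sub>M i\<in>?K. Q" by (intro prob_space_PiM Q)
  have X': "X \<in> space (\<Pi>\<^sub>M i\<in>{1..n}. borel)"
    using X sets_eq_imp_space_eq[OF sets_PX] by simp
  have \<pi>': "?\<pi>' \<in> perms n"
    using \<pi> ij by (intro transpose_perms) (auto simp: perms_iff permutes_in_image simp del: atLeastAtMost_iff)
  have Z: "(\<lambda>Z. Z) \<in> measurable PZ (\<Pi>\<^sub>M i\<in>{1..n}. borel)"
    by measurable
  have N: "?N \<in> measurable PZ (\<Pi>\<^sub>M i\<in>{1..n}. borel)" "?N' \<in> measurable PZ (\<Pi>\<^sub>M i\<in>{1..n}. borel)"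
    using X' by (intro measurable_noisy_obs \<pi> \<pi>' measurable_const Z; simp)+
  have [measurable_cong]: "sets Q = sets borel" by (rule sets_Q)
  have FN: "(\<lambda>Z. F (?N Z)) \<in> borel_measurable PZ" "(\<lambda>Z. F' (?N' Z)) \<in> borel_measurable PZ"
    by (rule measurable_compose[OF N(1) F] measurable_compose[OF N(2) F'])+
  have "?\<kappa> = (\<integral>\<^sup>+w. ?\<kappa> \<partial>(\<Pi>\<^sub>M i\<in>?K. Q))"
    unfolding nn_integral_const K.emeasure_space_1 by simp
  also have "\<dots> \<le> (\<integral>\<^sup>+w. \<integral>\<^sup>+b. \<integral>\<^sup>+a. F (?N (w(j := b, i := a))) + F' (?N' (w(j := b, i := a))) \<partial>Q \<partial>Q \<partial>(\<Pi>\<^sub>M i\<in>?K. Q))"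
  proof (rule nn_integral_mono)
    fix w
    let ?u = "?N w"
    define H where "H = (\<lambda>x. F (?u(j := snd x, i := fst x)))"
    define H' where "H' = (\<lambda>x. F' (?u(j := snd x, i := fst x)))"
    have m: "(\<lambda>x k. (?u(j := snd x, i := fst x)) k) \<in> measurable (borel \<Otimes>\<^sub>M borel) (\<Pi>\<^sub>M i\<in>{1..n}. borel)"
    proof (rule measurable_PiM_single')
      fix k assume "k \<in> {1..n}"
      show "(\<lambda>x. (?u(j := snd x, i := fst x)) k) \<in> borel_measurable (borel \<Otimes>\<^sub>M borel)"
        by (cases "k = i"; cases "k = j") auto
    next
      \<comment> \<open>\<open>noisy_obs\<close> is undefined outside the index set and both updates
        happen inside it, so the result is still an element of the product space.\<close>
      show "(\<lambda>x k. (?u(j := snd x, i := fst x)) k) \<in> space (borel \<Otimes>\<^sub>M borel) \<rightarrow> (\<Pi>\<^sub>E k\<in>{1..n}. space borel)"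
        using ij by (auto simp: noisy_obs_def PiE_def extensional_def)
    qed
    have H[measurable]: "H \<in> borel_measurable (borel \<Otimes>\<^sub>M borel)" "H' \<in> borel_measurable (borel \<Otimes>\<^sub>M borel)"
      unfolding H_def H'_def by (rule measurable_compose[OF m F] measurable_compose[OF m F'])+
    have "?\<kappa> \<le> (\<integral>\<^sup>+b. \<integral>\<^sup>+a. H (?c + s *\<^sub>R a, ?c' + s *\<^sub>R b) \<partial>Q \<partial>Q) +
       (\<integral>\<^sup>+b. \<integral>\<^sup>+a. H' (?c' + s *\<^sub>R a, ?c + s *\<^sub>R b) \<partial>Q \<partial>Q)"
      unfolding Q_eq by (rule nn_integral_affine_density_swap[OF q s \<delta> close H]) (auto simp: H_def H'_def FF')
    also have "\<dots> = (\<integral>\<^sup>+b. \<integral>\<^sup>+a. H (?c + s *\<^sub>R a, ?c' + s *\<^sub>R b) + H' (?c' + s *\<^sub>R a, ?c + s *\<^sub>R b) \<partial>Q \<partial>Q)"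
      by (simp add: nn_integral_add)
    also have "\<dots> = (\<integral>\<^sup>+b. \<integral>\<^sup>+a. F (?N (w(j := b, i := a))) + F' (?N' (w(j := b, i := a))) \<partial>Q \<partial>Q)"
      by (simp add: H_def H'_def noisy_obs_update2[OF \<pi> ij] noisy_obs_transpose_update2[OF \<pi> ij])
    finally show "?\<kappa> \<le> (\<integral>\<^sup>+b. \<integral>\<^sup>+a. F (?N (w(j := b, i := a))) + F' (?N' (w(j := b, i := a))) \<partial>Q \<partial>Q)" .
  qed
  also have "\<dots> = (\<integral>\<^sup>+Z. F (?N Z) + F' (?N' Z) \<partial>PZ)"
    by (rule nn_integral_PiM_two[symmetric])
      (use ij FN in \<open>auto intro: Q.sigma_finite_measure_axioms simp del: One_nat_def\<close>)
  also have "\<dots> = (\<integral>\<^sup>+Z. F (?N Z) \<partial>PZ) + (\<integral>\<^sup>+Z. F' (?N' Z) \<partial>PZ)"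
    by (rule nn_integral_add[OF FN])
  finally show ?thesis .
qed

text \<open>The term of (a, b) is an error at the position \<open>inv \<pi> a\<close>.
  Single-valuedness gives each a at most one partner, so different pairs are charged to different
  positions.\<close>

lemma hamming_dist_ge_partners:
  assumes \<pi>: "\<pi> \<in> perms n" and G: "G \<subseteq> {1..n} \<times> {1..n}" "single_valued G"
  shows "(\<Sum>p\<in>G. if \<tau> (inv \<pi> (fst p)) \<noteq> fst p then 1 else 0) \<le> hamming_dist n \<tau> \<pi>"
proof -
  have fin: "finite G" using G(1) finite_subset by blast
  have perm: "inv \<pi> permutes {1..n}" using \<pi> by (simp add: perms_iff permutes_inv)
  have "(\<Sum>p\<in>G. if \<tau> (inv \<pi> (fst p)) \<noteq> fst p then 1 else 0) = card {p \<in> G. \<tau> (inv \<pi> (fst p)) \<noteq> fst p}"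
    using fin by (simp add: sum.If_cases Int_def)
  also have "\<dots> \<le> hamming_dist n \<tau> \<pi>"
    unfolding hamming_dist_def
  proof (rule card_inj_on_le[where f = "\<lambda>p. inv \<pi> (fst p)"])
    show "inj_on (\<lambda>p. inv \<pi> (fst p)) {p \<in> G. \<tau> (inv \<pi> (fst p)) \<noteq> fst p}"
    proof (rule inj_onI)
      fix p p' assume "p \<in> {p \<in> G. \<tau> (inv \<pi> (fst p)) \<noteq> fst p}" "p' \<in> {p \<in> G. \<tau> (inv \<pi> (fst p)) \<noteq> fst p}"
        and "inv \<pi> (fst p) = inv \<pi> (fst p')"
      then have "p \<in> G" "p' \<in> G" "fst p = fst p'"
        using injD[OF permutes_inj[OF perm]] by auto
      then show "p = p'"
        using G(2) by (cases p; cases p') (auto dest: single_valuedD)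
    qed
    show "(\<lambda>p. inv \<pi> (fst p)) ` {p \<in> G. \<tau> (inv \<pi> (fst p)) \<noteq> fst p} \<subseteq> {j \<in> {1..n}. \<tau> j \<noteq> \<pi> j}"
      using G(1) permutes_in_image[OF perm] \<pi>
      by (auto simp: perms_iff permutes_inverses simp del: atLeastAtMost_iff)
  qed simp
  finally show ?thesis .
qed

text \<open>For each pair (a, b) and each \<pi>, an error at a under \<pi> and an error at b under
  the transposed permutation have total probability at least \<kappa>. Summed over all pairs and
  permutations, each of the two contributions equals the same sum, which the Hamming distance
  dominates; this gives the factor 2.\<close>

lemma conditional_risk_lower_bound:
  fixes q :: "'a \<Rightarrow> real"
  assumes Q_eq: "Q = density lborel (\<lambda>x. ennreal (q x))"
    and q: "q \<in> borel_measurable borel"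
    and s: "0 < s" and \<delta>: "0 \<le> \<delta>" "\<And>z. z \<in> cball z0 (2 * r) \<Longrightarrow> \<delta> \<le> q z"
    and X: "X \<in> space PX" and f: "f \<in> estimators n"
    and G: "G \<subseteq> {1..n} \<times> {1..n}" "single_valued G" "sym G" "irrefl G"
    and close: "\<And>a b. (a, b) \<in> G \<Longrightarrow> dist (X a) (X b) \<le> r * s"
  defines "\<kappa> \<equiv> ennreal ((\<delta> * unit_ball_vol DIM('a) * r ^ DIM('a))\<^sup>2)"
  shows "of_nat (card G) * (fact n * \<kappa>) \<le>
    2 * (\<Sum>\<pi>\<in>perms n. \<integral>\<^sup>+Z. of_nat (hamming_dist n (f (X, noisy_obs n s X Z \<pi>)) \<pi>) \<partial>PZ)"
proof -
  \<comment> \<open>Errors are indexed by the value a and not by its position, since an isolated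
    pair fixes two values while their positions move with \<pi>.\<close>
  define miss :: "nat \<Rightarrow> (nat \<Rightarrow> nat) \<Rightarrow> (nat \<Rightarrow> nat) \<Rightarrow> ennreal"
    where "miss a \<pi> \<tau> = (if \<tau> (inv \<pi> a) \<noteq> a then 1 else 0)" for a \<pi> \<tau>
  define M where "M a \<pi> = (\<integral>\<^sup>+Z. miss a \<pi> (f (X, noisy_obs n s X Z \<pi>)) \<partial>PZ)" for a \<pi>
  have fin: "finite G" using G(1) finite_subset by blast
  have X': "X \<in> space (\<Pi>\<^sub>M i\<in>{1..n}. borel)"
    using X sets_eq_imp_space_eq[OF sets_PX] by simp
  have fm: "(\<lambda>y. f (X, y)) \<in> measurable (\<Pi>\<^sub>M i\<in>{1..n}. borel) (count_space (perms n))"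
    using f X' unfolding estimators_def by simp
  have Z: "(\<lambda>Z. Z) \<in> measurable PZ (\<Pi>\<^sub>M i\<in>{1..n}. borel)"
    by measurable
  have N: "(\<lambda>Z. noisy_obs n s X Z \<pi>) \<in> measurable PZ (\<Pi>\<^sub>M i\<in>{1..n}. borel)" if "\<pi> \<in> perms n" for \<pi>
    using X' that by (intro measurable_noisy_obs measurable_const Z)
  have meas: "(\<lambda>Z. miss a \<pi> (f (X, noisy_obs n s X Z \<pi>))) \<in> borel_measurable PZ" if "\<pi> \<in> perms n" for a \<pi>
    by (rule measurable_compose[OF measurable_compose[OF N[OF that] fm]]) simp
  have "(\<Sum>\<pi>\<in>perms n. \<Sum>p\<in>G. M (fst p) \<pi>) =
    (\<Sum>\<pi>\<in>perms n. \<integral>\<^sup>+Z. (\<Sum>p\<in>G. miss (fst p) \<pi> (f (X, noisy_obs n s X Z \<pi>))) \<partial>PZ)"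
    unfolding M_def using meas by (intro sum.cong refl nn_integral_sum[symmetric])
  also have "\<dots> \<le> (\<Sum>\<pi>\<in>perms n. \<integral>\<^sup>+Z. of_nat (hamming_dist n (f (X, noisy_obs n s X Z \<pi>)) \<pi>) \<partial>PZ)"
  proof (intro sum_mono nn_integral_mono)
    fix \<pi> Z assume "\<pi> \<in> perms n"
    from hamming_dist_ge_partners[OF this G(1,2), of "f (X, noisy_obs n s X Z \<pi>)"]
    have "of_nat (\<Sum>p\<in>G. if f (X, noisy_obs n s X Z \<pi>) (inv \<pi> (fst p)) \<noteq> fst p then 1 else 0) \<le>
      (of_nat (hamming_dist n (f (X, noisy_obs n s X Z \<pi>)) \<pi>) :: ennreal)"
      by (rule of_nat_mono)
    then show "(\<Sum>p\<in>G. miss (fst p) \<pi> (f (X, noisy_obs n s X Z \<pi>)))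
      \<le> of_nat (hamming_dist n (f (X, noisy_obs n s X Z \<pi>)) \<pi>)"
      unfolding miss_def of_nat_sum by (simp add: if_distrib cong: if_cong)
  qed
  finally have le: "(\<Sum>p\<in>G. \<Sum>\<pi>\<in>perms n. M (fst p) \<pi>) \<le>
    (\<Sum>\<pi>\<in>perms n. \<integral>\<^sup>+Z. of_nat (hamming_dist n (f (X, noisy_obs n s X Z \<pi>)) \<pi>) \<partial>PZ)"
    by (subst sum.swap)
  \<comment> \<open>Symmetry of \<open>G\<close> exchanges the roles of a and b, and composition
    with a transposition is an involution of \<open>perms n\<close>.\<close>
  have swap: "(\<Sum>p\<in>G. \<Sum>\<pi>\<in>perms n. M (fst p) \<pi>) =
    (\<Sum>p\<in>G. \<Sum>\<pi>\<in>perms n. M (snd p) (Transposition.transpose (fst p) (snd p) \<circ> \<pi>))"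
  proof -
    have "(\<Sum>p\<in>G. \<Sum>\<pi>\<in>perms n. M (fst p) \<pi>) = (\<Sum>p\<in>G. \<Sum>\<pi>\<in>perms n. M (snd p) \<pi>)"
      by (rule sum.reindex_bij_witness[of _ prod.swap prod.swap]) (use G(3) in \<open>auto simp: sym_def\<close>)
    also have "\<dots> = (\<Sum>p\<in>G. \<Sum>\<pi>\<in>perms n. M (snd p) (Transposition.transpose (fst p) (snd p) \<circ> \<pi>))"
    proof (rule sum.cong[OF refl])
      fix p assume "p \<in> G"
      then have p: "fst p \<in> {1..n}" "snd p \<in> {1..n}" using G(1) by auto
      show "(\<Sum>\<pi>\<in>perms n. M (snd p) \<pi>) = (\<Sum>\<pi>\<in>perms n. M (snd p) (Transposition.transpose (fst p) (snd p) \<circ> \<pi>))"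
        by (rule sum.reindex_bij_witness[of _ "\<lambda>\<pi>. Transposition.transpose (fst p) (snd p) \<circ> \<pi>" "\<lambda>\<pi>. Transposition.transpose (fst p) (snd p) \<circ> \<pi>"])
          (use p in \<open>auto simp: o_assoc intro: transpose_perms\<close>)
    qed
    finally show ?thesis .
  qed
  have pair: "\<kappa> \<le> M (fst p) \<pi> + M (snd p) (Transposition.transpose (fst p) (snd p) \<circ> \<pi>)"
    if p: "p \<in> G" and \<pi>: "\<pi> \<in> perms n" for p \<pi>
  proof -
    obtain a b where ab: "p = (a, b)" by force
    have a: "a \<in> {1..n}" "b \<in> {1..n}" "a \<noteq> b"
      using p G(1,4) unfolding ab by (auto simp: irrefl_def)
    define i j where "i = inv \<pi> a" and "j = inv \<pi> b"
    have perm: "\<pi> permutes {1..n}" using \<pi> by (simp add: perms_iff)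
    have ij: "i \<in> {1..n}" "j \<in> {1..n}" "i \<noteq> j" "\<pi> i = a" "\<pi> j = b"
    proof -
      show "i \<in> {1..n}" "j \<in> {1..n}"
        unfolding i_def j_def using a by (simp_all only: permutes_in_image[OF permutes_inv[OF perm]])
      show "\<pi> i = a" "\<pi> j = b"
        unfolding i_def j_def by (simp_all only: permutes_inverses(1)[OF perm])
      then show "i \<noteq> j" using a(3) by blast
    qed
    have perm': "Transposition.transpose a b \<circ> \<pi> permutes {1..n}"
      using transpose_perms[OF \<pi> a(1,2)] by (simp add: perms_iff)
    \<comment> \<open>The transposed permutation has b exactly where \<pi> has a. Both errors
      therefore concern the single number \<open>f (X, y) i\<close>, which cannot equal both a and
      b.\<close>
    have inv': "inv (Transposition.transpose a b \<circ> \<pi>) b = i"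
      by (simp add: permutes_inv_eq[OF perm'] ij)
    let ?F = "\<lambda>c y. if f (X, y) i \<noteq> c then 1 else 0 :: ennreal"
    have F: "?F c \<in> borel_measurable (\<Pi>\<^sub>M i\<in>{1..n}. borel)" for c
      by (rule measurable_compose[OF fm]) simp
    have "\<kappa> \<le> (\<integral>\<^sup>+Z. ?F a (noisy_obs n s X Z \<pi>) \<partial>PZ) +
      (\<integral>\<^sup>+Z. ?F b (noisy_obs n s X Z (Transposition.transpose (\<pi> i) (\<pi> j) \<circ> \<pi>)) \<partial>PZ)"
      unfolding \<kappa>_def
      by (rule swap_lower_bound[OF Q_eq q s \<delta> \<pi> ij(1-3) X _ F F])
        (use ij close[of a b] p ab a in auto)
    then show ?thesis
      unfolding M_def miss_def ab fst_conv snd_conv inv' ij i_def[symmetric] .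
  qed
  have "of_nat (card G) * (fact n * \<kappa>) = (\<Sum>p\<in>G. \<Sum>\<pi>\<in>perms n. \<kappa>)"
    by simp
  also have "\<dots> \<le> (\<Sum>p\<in>G. \<Sum>\<pi>\<in>perms n. M (fst p) \<pi> + M (snd p) (Transposition.transpose (fst p) (snd p) \<circ> \<pi>))"
    by (intro sum_mono pair)
  also have "\<dots> = 2 * (\<Sum>p\<in>G. \<Sum>\<pi>\<in>perms n. M (fst p) \<pi>)"
    by (simp add: sum.distrib swap mult_2)
  also have "\<dots> \<le> 2 * (\<Sum>\<pi>\<in>perms n. \<integral>\<^sup>+Z. of_nat (hamming_dist n (f (X, noisy_obs n s X Z \<pi>)) \<pi>) \<partial>PZ)"
    by (intro mult_left_mono le) auto
  finally show ?thesis .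
qed

end

subsection \<open>Isolated pairs\<close>

lemma close_set_measurable:
  "{z :: 'a::euclidean_space \<times> 'a. dist (fst z) (snd z) \<le> t} \<in> sets (borel \<Otimes>\<^sub>M borel)"
  unfolding borel_prod by (intro borel_closed closed_Collect_le continuous_intros)

text \<open>The pairs are ordered, so the relation is symmetric, as the exchange argument requires.
  The complementary inequalities for partners and for third points make it a matching: an index with
  two partners would violate the strict one.\<close>

definition isolated_pairs :: "nat \<Rightarrow> real \<Rightarrow> (nat \<Rightarrow> 'a::metric_space) \<Rightarrow> (nat \<times> nat) set" where
  "isolated_pairs n t X = {(a, b) \<in> {1..n} \<times> {1..n}. a \<noteq> b \<and> dist (X a) (X b) \<le> t \<and>
     (\<forall>k\<in>{1..n} - {a, b}. t < dist (X k) (X a) \<and> t < dist (X k) (X b))}"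

lemma isolated_pairs_subset: "isolated_pairs n t X \<subseteq> {1..n} \<times> {1..n}"
  by (auto simp: isolated_pairs_def)

lemma single_valued_isolated_pairs: "single_valued (isolated_pairs n t X)"
proof (rule single_valuedI)
  fix a b c assume b: "(a, b) \<in> isolated_pairs n t X" and c: "(a, c) \<in> isolated_pairs n t X"
  show "b = c"
  proof (rule ccontr)
    assume "b \<noteq> c"
    then have "t < dist (X c) (X a)"
      using b c by (auto simp: isolated_pairs_def)
    moreover have "dist (X a) (X c) \<le> t"
      using c by (auto simp: isolated_pairs_def)
    ultimately show False by (simp add: dist_commute)
  qed
qed

lemma sym_isolated_pairs: "sym (isolated_pairs n t X)"
  by (rule symI) (auto simp: isolated_pairs_def dist_commute)

lemma irrefl_isolated_pairs: "irrefl (isolated_pairs n t X)"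
  by (rule irreflI) (auto simp: isolated_pairs_def)

section \<open>Probability that a given pair is isolated\<close>

context shuffled_observations
begin

lemma emeasure_cball_le:
  assumes p[measurable]: "p \<in> borel_measurable borel" and P_eq: "P = density lborel (\<lambda>x. ennreal (p x))"
    and b: "\<And>x. p x \<le> b" and t: "0 \<le> t"
  shows "emeasure P (cball x t) \<le> ennreal (b * unit_ball_vol DIM('a) * t ^ DIM('a))"
proof -
  have "emeasure P (cball x t) = (\<integral>\<^sup>+y. ennreal (p y) * indicator (cball x t) y \<partial>lborel)"
    unfolding P_eq by (simp add: emeasure_density)
  also have "\<dots> \<le> (\<integral>\<^sup>+y. ennreal b * indicator (cball x t) y \<partial>lborel)"
    by (intro nn_integral_mono mult_right_mono ennreal_leI b) auto
  also have "\<dots> = ennreal b * emeasure lborel (cball x t)"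
    by (rule nn_integral_cmult_indicator) simp
  also have "\<dots> = ennreal (b * unit_ball_vol DIM('a) * t ^ DIM('a))"
    using t by (simp add: emeasure_cball ennreal_mult'' mult.assoc)
  finally show ?thesis .
qed

text \<open>Let y range over the ball of radius \<rho> around x0 and x over the ball of radius t
  around y. As t is at most \<rho>, both points stay within 2 \<rho> of x0, where the density is at
  least \<eta>; the two ball volumes supply the remaining factors.\<close>

lemma close_pair_ge:
  assumes p[measurable]: "p \<in> borel_measurable borel" and P_eq: "P = density lborel (\<lambda>x. ennreal (p x))"
    and \<eta>: "0 \<le> \<eta>" "\<And>x. x \<in> cball x0 (2 * \<rho>) \<Longrightarrow> \<eta> \<le> p x" and t: "0 \<le> t" "t \<le> \<rho>"
  shows "ennreal (\<eta>\<^sup>2 * (unit_ball_vol DIM('a))\<^sup>2 * \<rho> ^ DIM('a) * t ^ DIM('a)) \<le>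
    (\<integral>\<^sup>+y. \<integral>\<^sup>+x. indicator {z. dist (fst z) (snd z) \<le> t} (x, y) \<partial>P \<partial>P)"
proof -
  let ?v = "unit_ball_vol (real DIM('a))"
  have "ennreal (\<eta>\<^sup>2 * ?v\<^sup>2 * \<rho> ^ DIM('a) * t ^ DIM('a)) =
    ennreal \<eta> * (ennreal \<eta> * ennreal (?v * t ^ DIM('a))) * ennreal (?v * \<rho> ^ DIM('a))"
    using \<eta>(1) t by (simp add: ennreal_mult[symmetric] power2_eq_square ac_simps)
  also have "\<dots> = (\<integral>\<^sup>+y. ennreal \<eta> * (ennreal \<eta> * ennreal (?v * t ^ DIM('a))) * indicator (cball x0 \<rho>) y \<partial>lborel)"
    using t by (subst nn_integral_cmult_indicator) (auto simp: emeasure_cball)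
  also have "\<dots> \<le> (\<integral>\<^sup>+y. ennreal (p y) * (\<integral>\<^sup>+x. indicator {z. dist (fst z) (snd z) \<le> t} (x, y) \<partial>P) \<partial>lborel)"
  proof (rule nn_integral_mono)
    fix y
    show "ennreal \<eta> * (ennreal \<eta> * ennreal (?v * t ^ DIM('a))) * indicator (cball x0 \<rho>) y \<le>
      ennreal (p y) * (\<integral>\<^sup>+x. indicator {z. dist (fst z) (snd z) \<le> t} (x, y) \<partial>P)"
    proof (cases "y \<in> cball x0 \<rho>")
      case True
      have "ennreal \<eta> * ennreal (?v * t ^ DIM('a)) = (\<integral>\<^sup>+x. ennreal \<eta> * indicator (cball y t) x \<partial>lborel)"
        using t by (subst nn_integral_cmult_indicator) (auto simp: emeasure_cball)
      also have "\<dots> \<le> (\<integral>\<^sup>+x. ennreal (p x) * indicator {z. dist (fst z) (snd z) \<le> t} (x, y) \<partial>lborel)"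
      proof (rule nn_integral_mono)
        fix x
        show "ennreal \<eta> * indicator (cball y t) x \<le> ennreal (p x) * indicator {z. dist (fst z) (snd z) \<le> t} (x, y)"
        proof (cases "x \<in> cball y t")
          case x: True
          have "dist x0 x \<le> dist x0 y + dist y x" by (rule dist_triangle)
          also have "\<dots> \<le> 2 * \<rho>" using True x t by simp
          finally have "\<eta> \<le> p x" using \<eta>(2) by simp
          then show ?thesis using x by (simp add: dist_commute ennreal_leI)
        qed simp
      qed
      also have "\<dots> = (\<integral>\<^sup>+x. indicator {z. dist (fst z) (snd z) \<le> t} (x, y) \<partial>P)"
        unfolding P_eq by (subst nn_integral_density) (simp_all add: indicator_def)
      finally have 1: "ennreal \<eta> * ennreal (?v * t ^ DIM('a)) \<le> (\<integral>\<^sup>+x. indicator {z. dist (fst z) (snd z) \<le> t} (x, y) \<partial>P)" .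
      have "dist x0 y \<le> 2 * \<rho>"
        using True t by simp
      then have "\<eta> \<le> p y"
        using \<eta>(2) by simp
      then have "ennreal \<eta> * (ennreal \<eta> * ennreal (?v * t ^ DIM('a))) \<le>
          ennreal (p y) * (\<integral>\<^sup>+x. indicator {z. dist (fst z) (snd z) \<le> t} (x, y) \<partial>P)"
        by (intro mult_mono 1 ennreal_leI) auto
      then show ?thesis
        using True by (simp del: mem_cball)
    qed simp
  qed
  also have "\<dots> = (\<integral>\<^sup>+y. \<integral>\<^sup>+x. indicator {z. dist (fst z) (snd z) \<le> t} (x, y) \<partial>P \<partial>P)"
  proof -
    interpret P: prob_space P by (rule P)
    have [measurable_cong]: "sets P = sets borel" by (rule sets_P)
    have [measurable]: "{z. dist (fst z) (snd z) \<le> t} \<in> sets (borel \<Otimes>\<^sub>M (borel :: 'a measure))"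
      by (rule close_set_measurable)
    have "(\<lambda>y. \<integral>\<^sup>+x. indicator {z. dist (fst z) (snd z) \<le> t} (x, y) \<partial>P) \<in> borel_measurable borel"
      by measurable
    then have "(\<integral>\<^sup>+y. g y \<partial>P) = (\<integral>\<^sup>+y. ennreal (p y) * g y \<partial>lborel)"
      if "g = (\<lambda>y. \<integral>\<^sup>+x. indicator {z. dist (fst z) (snd z) \<le> t} (x, y) \<partial>P)" for g
      unfolding that by (subst P_eq) (simp add: nn_integral_density)
    then show ?thesis by simp
  qed
  finally show ?thesis .
qed

lemma isolated_pair_measurable:
  assumes ab: "a \<in> {1..n}" "b \<in> {1..n}" "a \<noteq> b"
  shows "(\<lambda>X. indicator (isolated_pairs n t X) (a, b) :: ennreal) \<in> borel_measurable PX"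
proof -
  have comp: "(\<lambda>X. X k) \<in> borel_measurable PX" if "k \<in> {1..n}" for k
    by (subst measurable_cong_sets[OF refl sets_P[symmetric]])
      (rule measurable_component_singleton[OF that])
  have "Measurable.pred PX (\<lambda>X. dist (X a) (X b) \<le> t \<and>
      (\<forall>k\<in>{1..n} - {a, b}. t < dist (X k) (X a) \<and> t < dist (X k) (X b)))"
    by (intro pred_intros_logic pred_intros_finite) (use ab in \<open>simp_all del: One_nat_def add: comp\<close>)
  then show ?thesis
    using ab unfolding isolated_pairs_def indicator_def by simp
qed

text \<open>A union bound. If a close pair is not isolated, some third point is within t of one of
  its two members, and given the pair each such event has probability at most B v t^d, with v the
  volume of the unit ball. There are 2 (n - 2) events, so the constant 4 in \<open>small\<close>
  makes their total at most half the probability of closeness.\<close>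

lemma isolated_pair_prob_ge:
  assumes p[measurable]: "p \<in> borel_measurable borel" and P_eq: "P = density lborel (\<lambda>x. ennreal (p x))"
    and bound: "\<And>x. p x \<le> B" and t: "0 \<le> t"
    and small: "4 * real n * (B * unit_ball_vol DIM('a) * t ^ DIM('a)) \<le> 1"
    and ab: "a \<in> {1..n}" "b \<in> {1..n}" "a \<noteq> b"
  shows "(\<integral>\<^sup>+y. \<integral>\<^sup>+x. indicator {z. dist (fst z) (snd z) \<le> t} (x, y) \<partial>P \<partial>P) \<le>
    2 * (\<integral>\<^sup>+X. indicator (isolated_pairs n t X) (a, b) \<partial>PX)"
proof -
  interpret P: prob_space P by (rule P)
  interpret PX: prob_space PX by (intro prob_space_PiM P)
  interpret product_sigma_finite "\<lambda>_. P" by standard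
  let ?u = "B * unit_ball_vol DIM('a) * t ^ DIM('a)"
  let ?close = "\<lambda>a b X. indicator {X. dist (X a) (X b) \<le> t} X :: ennreal"
  have comp: "(\<lambda>X. X k) \<in> borel_measurable PX" if "k \<in> {1..n}" for k
    by (subst measurable_cong_sets[OF refl sets_P[symmetric]])
      (rule measurable_component_singleton[OF that])
  have close_meas: "?close a b \<in> borel_measurable PX" if "a \<in> {1..n}" "b \<in> {1..n}" for a b
  proof -
    note [measurable] = comp[OF that(1)] comp[OF that(2)]
    show ?thesis unfolding indicator_def mem_Collect_eq by measurable
  qed
  define c where "c = (\<integral>\<^sup>+X. ?close a b X \<partial>PX)"
  define g where "g = (\<integral>\<^sup>+X. indicator (isolated_pairs n t X) (a, b) \<partial>PX)"
  have le_1: "(\<integral>\<^sup>+X. h X \<partial>PX) \<le> 1" if "\<And>X. h X \<le> 1" for h :: "(nat \<Rightarrow> 'a) \<Rightarrow> ennreal"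
  proof -
    have "(\<integral>\<^sup>+X. h X \<partial>PX) \<le> (\<integral>\<^sup>+X. 1 \<partial>PX)"
      by (intro nn_integral_mono that)
    also have "\<dots> = 1"
      unfolding nn_integral_const PX.emeasure_space_1 by simp
    finally show ?thesis .
  qed
  have c1: "c \<le> 1"
    unfolding c_def by (rule le_1) (simp add: indicator_def)
  \<comment> \<open>As \<open>k\<close> differs from \<open>a\<close> and \<open>b\<close>,
    integrating out \<open>X k\<close> first leaves the closeness of the pair as a constant factor
    and asks only for the mass of one ball.\<close>
  have third: "(\<integral>\<^sup>+X. ?close a b X * ?close k e X \<partial>PX) \<le> c * ennreal ?u"
    if k: "k \<in> {1..n} - {a, b}" and e: "e \<in> {a, b}" for k e
  proof -
    let ?K = "{1..n} - {k}"
    have K: "finite ?K" "k \<notin> ?K" "{1..n} = insert k ?K" using k by auto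
    have ins: "(\<integral>\<^sup>+X. h X \<partial>PX) = (\<integral>\<^sup>+w. \<integral>\<^sup>+x. h (w(k := x)) \<partial>P \<partial>(\<Pi>\<^sub>M i\<in>?K. P))"
      if "h \<in> borel_measurable PX" for h
      using product_nn_integral_insert[OF K(1,2), of h] that unfolding K(3)[symmetric] .
    have "(\<integral>\<^sup>+X. ?close a b X * ?close k e X \<partial>PX) =
      (\<integral>\<^sup>+w. \<integral>\<^sup>+x. ?close a b (w(k := x)) * ?close k e (w(k := x)) \<partial>P \<partial>(\<Pi>\<^sub>M i\<in>?K. P))"
      using k e ab by (intro ins borel_measurable_times_ennreal close_meas) auto
    also have "\<dots> \<le> (\<integral>\<^sup>+w. \<integral>\<^sup>+x. ?close a b (w(k := x)) * ennreal ?u \<partial>P \<partial>(\<Pi>\<^sub>M i\<in>?K. P))"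
    proof (rule nn_integral_mono)
      fix w
      have ne: "a \<noteq> k" "b \<noteq> k" "e \<noteq> k" using k e by auto
      have "(\<integral>\<^sup>+x. ?close a b (w(k := x)) * ?close k e (w(k := x)) \<partial>P) =
        (\<integral>\<^sup>+x. ?close a b w * indicator (cball (w e) t) x \<partial>P)"
        using ne by (intro nn_integral_cong) (auto simp: indicator_def dist_commute)
      also have "\<dots> = ?close a b w * emeasure P (cball (w e) t)"
        by (rule nn_integral_cmult_indicator) (simp add: sets_P)
      also have "\<dots> \<le> ?close a b w * ennreal ?u"
        by (intro mult_left_mono emeasure_cball_le[OF p P_eq bound t]) auto
      also have "\<dots> = (\<integral>\<^sup>+x. ?close a b (w(k := x)) * ennreal ?u \<partial>P)"
        using ne by (simp add: indicator_def P.emeasure_space_1)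
      finally show "(\<integral>\<^sup>+x. ?close a b (w(k := x)) * ?close k e (w(k := x)) \<partial>P) \<le>
        (\<integral>\<^sup>+x. ?close a b (w(k := x)) * ennreal ?u \<partial>P)" .
    qed
    also have "\<dots> = (\<integral>\<^sup>+X. ?close a b X * ennreal ?u \<partial>PX)"
      using ab by (intro ins[symmetric] borel_measurable_times_ennreal close_meas borel_measurable_const)
    also have "\<dots> = c * ennreal ?u"
      unfolding c_def by (rule nn_integral_multc[OF close_meas[OF ab(1,2)]])
    finally show ?thesis .
  qed
  note iso_meas = isolated_pair_measurable[OF ab]
  have "c \<le> (\<integral>\<^sup>+X. indicator (isolated_pairs n t X) (a, b) +
    (\<Sum>k\<in>{1..n} - {a, b}. \<Sum>e\<in>{a, b}. ?close a b X * ?close k e X) \<partial>PX)"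
    unfolding c_def
  proof (rule nn_integral_mono)
    fix X :: "nat \<Rightarrow> 'a"
    show "?close a b X \<le> indicator (isolated_pairs n t X) (a, b) +
      (\<Sum>k\<in>{1..n} - {a, b}. \<Sum>e\<in>{a, b}. ?close a b X * ?close k e X)"
    proof (cases "dist (X a) (X b) \<le> t \<and> (a, b) \<notin> isolated_pairs n t X")
      case True
      then have "\<exists>k\<in>{1..n} - {a, b}. \<exists>e\<in>{a, b}. dist (X k) (X e) \<le> t"
        using ab unfolding isolated_pairs_def by (auto simp: not_less)
      then obtain k e where k: "k \<in> {1..n} - {a, b}" "e \<in> {a, b}" "dist (X k) (X e) \<le> t"
        by blast
      have "?close a b X = ?close a b X * ?close k e X"
        using True k by simp
      also have "\<dots> \<le> (\<Sum>e\<in>{a, b}. ?close a b X * ?close k e X)"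
        using k(2) by (intro member_le_sum) auto
      also have "\<dots> \<le> (\<Sum>k\<in>{1..n} - {a, b}. \<Sum>e\<in>{a, b}. ?close a b X * ?close k e X)"
        using k(1) by (intro member_le_sum[where f = "\<lambda>k. \<Sum>e\<in>{a, b}. ?close a b X * ?close k e X"]) auto
      finally show ?thesis by (simp add: add_increasing)
    next
      case False
      then show ?thesis
        by (cases "(a, b) \<in> isolated_pairs n t X") (auto simp: indicator_def add_increasing2)
    qed
  qed
  also have "\<dots> = g + (\<Sum>k\<in>{1..n} - {a, b}. \<Sum>e\<in>{a, b}. \<integral>\<^sup>+X. ?close a b X * ?close k e X \<partial>PX)"
  proof -
    have m: "(\<lambda>X. ?close a b X * ?close k e X) \<in> borel_measurable PX"
      if "k \<in> {1..n} - {a, b}" "e \<in> {a, b}" for k e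
      using that ab by (intro borel_measurable_times_ennreal close_meas) auto
    show ?thesis
      unfolding g_def
      by (subst nn_integral_add[OF iso_meas], intro borel_measurable_sum m, assumption, assumption,
          subst nn_integral_sum, intro borel_measurable_sum m, assumption, assumption,
          intro arg_cong2[where f = "(+)"] refl sum.cong nn_integral_sum m)
  qed
  also have "\<dots> \<le> g + (\<Sum>k\<in>{1..n} - {a, b}. \<Sum>e\<in>{a, b}. c * ennreal ?u)"
    by (intro add_left_mono sum_mono third)
  finally have c_le: "c \<le> g + (\<Sum>k\<in>{1..n} - {a, b}. \<Sum>e\<in>{a, b}. c * ennreal ?u)" .
  moreover have "(\<Sum>k\<in>{1..n} - {a, b}. \<Sum>e\<in>{a, b}. c * ennreal ?u) \<le> c * ennreal (1 / 2)"
  proof -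
    \<comment> \<open>\<open>B\<close> comes without a sign, but a negative upper bound would make
      the density vanish identically, contradicting total mass one.\<close>
    have u: "0 \<le> ?u"
    proof (rule ccontr)
      assume "\<not> 0 \<le> ?u"
      then have "B < 0"
        using t by (simp add: zero_le_mult_iff)
      then have "ennreal (p x) = 0" for x
        using bound[of x] by (simp add: ennreal_neg)
      then show False
        using P.emeasure_space_1 by (simp add: P_eq emeasure_density)
    qed
    have "(\<Sum>k\<in>{1..n} - {a, b}. \<Sum>e\<in>{a, b}. c * ennreal ?u) = c * (of_nat (n - 2) * (2 * ennreal ?u))"
      using ab by (simp add: card_Diff_subset ac_simps numeral_2_eq_2)
    also have "\<dots> = c * ennreal (real (n - 2) * (2 * ?u))"
      using u by (simp add: ennreal_mult ennreal_of_nat_eq_real_of_nat)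
    also have "\<dots> \<le> c * ennreal (1 / 2)"
    proof (intro mult_left_mono ennreal_leI)
      have "real (n - 2) * (2 * ?u) \<le> real n * (2 * ?u)"
        using u by (intro mult_right_mono) auto
      also have "\<dots> \<le> 1 / 2" using small by simp
      finally show "real (n - 2) * (2 * ?u) \<le> 1 / 2" .
    qed simp
    finally show ?thesis .
  qed
  ultimately have "c \<le> g + c * ennreal (1 / 2)"
    by (intro order_trans[OF c_le] add_left_mono)
  moreover have "g \<le> 1"
    unfolding g_def by (rule le_1) (simp add: indicator_def)
  \<comment> \<open>Half of \<open>c\<close> has to be subtracted from both sides, which is
    legitimate only for finite values; hence the passage to real numbers.\<close>
  moreover have "c \<le> 2 * g" if cg: "c \<le> g + c * ennreal (1 / 2)" "g \<le> 1"
  proof -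
    obtain c' g' where *: "0 \<le> c'" "c = ennreal c'" "0 \<le> g'" "g = ennreal g'"
      using c1 cg(2) by (cases c; cases g) (auto simp: top_unique)
    have half: "c * ennreal (1 / 2) = ennreal (c' * (1 / 2))"
      unfolding *(2) using *(1) by (intro ennreal_mult[symmetric]) auto
    have "g + c * ennreal (1 / 2) = ennreal (g' + c' * (1 / 2))"
      unfolding half unfolding *(4) using *(1,3) by (intro ennreal_plus[symmetric]) auto
    with cg(1) have "ennreal c' \<le> ennreal (g' + c' * (1 / 2))"
      using *(2) by (simp only:)
    then have "c' \<le> g' + c' * (1 / 2)"
      using * by (subst (asm) ennreal_le_iff) auto
    then have "ennreal c' \<le> ennreal (2 * g')"
      by (intro ennreal_leI) simp
    then show "c \<le> 2 * g" using * by (simp add: ennreal_mult)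
  qed
  ultimately have "c \<le> 2 * g" by blast
  moreover have "c = (\<integral>\<^sup>+y. \<integral>\<^sup>+x. indicator {z. dist (fst z) (snd z) \<le> t} (x, y) \<partial>P \<partial>P)"
  proof -
    have [measurable_cong]: "sets P = sets borel" by (rule sets_P)
    have "{z. dist (fst z) (snd z) \<le> t} \<in> sets (borel \<Otimes>\<^sub>M (borel :: 'a measure))"
      by (rule close_set_measurable)
    then have "(\<lambda>z. indicator {z. dist (fst z) (snd z) \<le> t} z :: ennreal) \<in> borel_measurable (P \<Otimes>\<^sub>M P)"
      by measurable
    note pair = nn_integral_PiM_pair_marginal[of "\<lambda>_. P" "{1..n}" a b, OF P _ ab this]
    have "c = (\<integral>\<^sup>+X. indicator {z. dist (fst z) (snd z) \<le> t} (X a, X b) \<partial>PX)"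
      unfolding c_def by (intro nn_integral_cong) (simp add: indicator_def)
    then show ?thesis using pair by simp
  qed
  ultimately show ?thesis by (simp add: g_def)
qed

end

subsection \<open>Nearest-neighbour matching\<close>

text \<open>A tie counts as a mismatch. Outside this set \<tau> i is thus the only nearest index, so
  two permutations that both avoid a mismatch at i must agree there.\<close>

definition mismatches ::
  "nat \<Rightarrow> (nat \<Rightarrow> 'a::metric_space) \<Rightarrow> (nat \<Rightarrow> 'a) \<Rightarrow> (nat \<Rightarrow> nat) \<Rightarrow> nat set" where
  "mismatches n X Y \<tau> =
    {i \<in> {1..n}. \<exists>j\<in>{1..n} - {\<tau> i}. dist (X j) (Y i) \<le> dist (X (\<tau> i)) (Y i)}"

text \<open>Two observations may share a nearest point, so choosing nearest points separately need
  not give a permutation. Minimising over \<open>perms n\<close> does, and the true permutation is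
  one of the competitors, so the minimiser has no more mismatches than it.\<close>

definition nearest_matching ::
  "nat \<Rightarrow> (nat \<Rightarrow> 'a::metric_space) \<times> (nat \<Rightarrow> 'a) \<Rightarrow> (nat \<Rightarrow> nat)" where
  "nearest_matching n = (\<lambda>(X, Y). arg_min_on (\<lambda>\<tau>. card (mismatches n X Y \<tau>)) (perms n))"

lemma hamming_dist_mismatches:
  assumes "\<tau> \<in> perms n" "\<pi> \<in> perms n"
  shows "hamming_dist n \<tau> \<pi> \<le> card (mismatches n X Y \<tau>) + card (mismatches n X Y \<pi>)"
proof -
  have "{j \<in> {1..n}. \<tau> j \<noteq> \<pi> j} \<subseteq> mismatches n X Y \<tau> \<union> mismatches n X Y \<pi>"
  proof
    fix i assume i: "i \<in> {j \<in> {1..n}. \<tau> j \<noteq> \<pi> j}"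
    then have "\<tau> i \<in> {1..n}" "\<pi> i \<in> {1..n}"
      using assms by (auto simp: perms_iff permutes_in_image simp del: atLeastAtMost_iff)
    with i show "i \<in> mismatches n X Y \<tau> \<union> mismatches n X Y \<pi>"
      using linear[of "dist (X (\<tau> i)) (Y i)" "dist (X (\<pi> i)) (Y i)"]
      unfolding mismatches_def by auto
  qed
  then have "hamming_dist n \<tau> \<pi> \<le> card (mismatches n X Y \<tau> \<union> mismatches n X Y \<pi>)"
    unfolding hamming_dist_def by (intro card_mono) (auto simp: mismatches_def)
  also have "\<dots> \<le> card (mismatches n X Y \<tau>) + card (mismatches n X Y \<pi>)"
    by (rule card_Un_le)
  finally show ?thesis .
qed

lemma hamming_dist_nearest_matching:
  assumes "\<pi> \<in> perms n"
  shows "hamming_dist n (nearest_matching n (X, Y)) \<pi> \<le> 2 * card (mismatches n X Y \<pi>)"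
proof -
  let ?\<tau> = "nearest_matching n (X, Y)"
  have "?\<tau> \<in> perms n" "card (mismatches n X Y ?\<tau>) \<le> card (mismatches n X Y \<pi>)"
    unfolding nearest_matching_def split_conv
    using arg_min_if_finite(1)[OF finite_perms perms_nonempty]
      arg_min_least[OF finite_perms perms_nonempty assms] by auto
  then show ?thesis
    using hamming_dist_mismatches[of ?\<tau> n \<pi> X Y] assms by simp
qed

text \<open>The data enter only through finitely many distance comparisons. \<open>closer\<close>
  records their outcomes as a finite set, and \<open>pick\<close> is a function on a finite discrete
  space, so however \<open>arg_min_on\<close> resolves ties, the composition is measurable.\<close>

lemma nearest_matching_estimator:
  "nearest_matching n \<in> (estimators n :: ((nat \<Rightarrow> 'a::euclidean_space) \<times> (nat \<Rightarrow> 'a) \<Rightarrow> _) set)"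
proof -
  let ?M = "(\<Pi>\<^sub>M i\<in>{1..n}. borel) \<Otimes>\<^sub>M (\<Pi>\<^sub>M i\<in>{1..n}. (borel :: 'a measure))"
  let ?I = "{1..n}"
  define closer where
    "closer w = {p \<in> ?I \<times> ?I \<times> ?I.
       dist (fst w (fst p)) (snd w (snd (snd p))) \<le> dist (fst w (fst (snd p))) (snd w (snd (snd p)))}"
    for w :: "(nat \<Rightarrow> 'a) \<times> (nat \<Rightarrow> 'a)"
  define pick where "pick R = arg_min_on
    (\<lambda>\<tau>. card {i \<in> ?I. \<exists>j\<in>?I - {\<tau> i}. (j, \<tau> i, i) \<in> R}) (perms n)" for R
  have eq: "nearest_matching n w = pick (closer w)" for w :: "(nat \<Rightarrow> 'a) \<times> (nat \<Rightarrow> 'a)"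
  proof -
    have *: "mismatches n (fst w) (snd w) \<tau> = {i \<in> ?I. \<exists>j\<in>?I - {\<tau> i}. (j, \<tau> i, i) \<in> closer w}"
      if "\<tau> \<in> perms n" for \<tau>
    proof -
      have "\<tau> i \<in> ?I" if "i \<in> ?I" for i
        using \<open>\<tau> \<in> perms n\<close> that by (simp add: perms_iff permutes_in_image del: atLeastAtMost_iff)
      then show ?thesis
        unfolding mismatches_def closer_def mem_Collect_eq mem_Times_iff fst_conv snd_conv by blast
    qed
    \<comment> \<open>\<open>arg_min_on\<close> is defined by choice, so the two minimisers are
      identified by showing that the choice is made from the same predicate; the objectives are only
      known to agree on \<open>perms n\<close>.\<close>
    then show ?thesis
      unfolding nearest_matching_def pick_def split_beta arg_min_on_def
      by (simp add: arg_min_def is_arg_min_def cong: conj_cong)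
  qed
  have comp: "(\<lambda>w. fst w k) \<in> borel_measurable ?M" "(\<lambda>w. snd w k) \<in> borel_measurable ?M" if "k \<in> ?I" for k
    using measurable_compose[OF measurable_fst measurable_component_singleton[OF that, of "\<lambda>_. borel"]]
      measurable_compose[OF measurable_snd measurable_component_singleton[OF that, of "\<lambda>_. borel"]] by auto
  have "closer \<in> ?M \<rightarrow>\<^sub>M count_space (Pow (?I \<times> ?I \<times> ?I))"
  proof (subst measurable_count_space_eq2, simp, intro conjI ballI)
    show "closer \<in> space ?M \<rightarrow> Pow (?I \<times> ?I \<times> ?I)" by (auto simp: closer_def)
  next
    fix A assume A: "A \<in> Pow (?I \<times> ?I \<times> ?I)"
    \<comment> \<open>That \<open>closer w\<close> equals \<open>A\<close> means that every
      comparison has the truth value prescribed by \<open>A\<close>: a finite conjunction of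
      measurable conditions.\<close>
    have "{w \<in> space ?M. \<forall>p\<in>?I \<times> ?I \<times> ?I.
      (dist (fst w (fst p)) (snd w (snd (snd p))) \<le> dist (fst w (fst (snd p))) (snd w (snd (snd p)))) = (p \<in> A)} \<in> sets ?M"
    proof (rule sets.sets_Collect_finite_All)
      fix p assume "p \<in> ?I \<times> ?I \<times> ?I"
      then have p: "fst p \<in> ?I" "fst (snd p) \<in> ?I" "snd (snd p) \<in> ?I" by auto
      note [measurable] = comp(1)[OF p(1)] comp(1)[OF p(2)] comp(2)[OF p(3)]
      show "{w \<in> space ?M. (dist (fst w (fst p)) (snd w (snd (snd p))) \<le> dist (fst w (fst (snd p))) (snd w (snd (snd p)))) = (p \<in> A)} \<in> sets ?M"
        by measurable
    qed simp
    also have "{w \<in> space ?M. \<forall>p\<in>?I \<times> ?I \<times> ?I.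
      (dist (fst w (fst p)) (snd w (snd (snd p))) \<le> dist (fst w (fst (snd p))) (snd w (snd (snd p)))) = (p \<in> A)}
      = closer -` {A} \<inter> space ?M"
      using A unfolding closer_def by blast
    finally show "closer -` {A} \<inter> space ?M \<in> sets ?M" .
  qed
  then have "(\<lambda>w. pick (closer w)) \<in> ?M \<rightarrow>\<^sub>M count_space (perms n)"
    by (rule measurable_compose) (auto simp: pick_def intro: arg_min_if_finite)
  then show ?thesis
    unfolding estimators_def eq[symmetric] by (simp add: eta_contract_eq)
qed

section \<open>Risk of nearest-neighbour matching\<close>

context shuffled_observations
begin

text \<open>Given X a = y and Z i = z, the event says that X b lies in the ball of radius s |z|
  around y + s z. Its mass is at most a constant times (s |z|)^d, so averaging over z brings in the
  moment of order d of the noise.\<close>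

lemma close_to_noisy_point_le:
  assumes p[measurable]: "p \<in> borel_measurable borel" and P_eq: "P = density lborel (\<lambda>x. ennreal (p x))"
    and bound: "\<And>x. p x \<le> B" and s: "0 \<le> s"
    and i: "i \<in> {1..n}" and ab: "a \<in> {1..n}" "b \<in> {1..n}" "a \<noteq> b"
  shows "(\<integral>\<^sup>+X. \<integral>\<^sup>+Z. indicator {w. dist (fst (fst w)) (snd (fst w) + s *\<^sub>R snd w) \<le> norm (s *\<^sub>R snd w)}
      ((X b, X a), Z i) \<partial>PZ \<partial>PX) \<le>
    ennreal (B * unit_ball_vol DIM('a) * s ^ DIM('a)) * (\<integral>\<^sup>+z. ennreal (norm z ^ DIM('a)) \<partial>Q)"
proof -
  interpret P: prob_space P by (rule P)
  interpret Q: prob_space Q by (rule Q)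
  interpret PQ: pair_sigma_finite P Q by standard
  have [measurable_cong]: "sets P = sets borel" "sets Q = sets borel" by (fact sets_P sets_Q)+
  let ?S = "{w. dist (fst (fst w)) (snd (fst w) + s *\<^sub>R snd w) \<le> norm (s *\<^sub>R snd w)} :: (('a \<times> 'a) \<times> 'a) set"
  have S: "?S \<in> sets ((borel \<Otimes>\<^sub>M borel) \<Otimes>\<^sub>M borel)"
    unfolding borel_prod by (intro borel_closed closed_Collect_le continuous_intros)
  then have ind[measurable]: "(\<lambda>w. indicator ?S w :: ennreal) \<in> borel_measurable ((borel \<Otimes>\<^sub>M borel) \<Otimes>\<^sub>M borel)"
    by measurable
  have "(\<integral>\<^sup>+X. \<integral>\<^sup>+Z. indicator ?S ((X b, X a), Z i) \<partial>PZ \<partial>PX) = (\<integral>\<^sup>+X. \<integral>\<^sup>+z. indicator ?S ((X b, X a), z) \<partial>Q \<partial>PX)"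
    by (intro nn_integral_cong nn_integral_PiM_marginal[where M = "\<lambda>_. Q"] Q i) measurable
  also have "\<dots> = (\<integral>\<^sup>+y. \<integral>\<^sup>+x. \<integral>\<^sup>+z. indicator ?S ((x, y), z) \<partial>Q \<partial>P \<partial>P)"
  proof -
    have "(\<lambda>w. \<integral>\<^sup>+z. indicator ?S (w, z) \<partial>Q) \<in> borel_measurable (P \<Otimes>\<^sub>M P)" by measurable
    from nn_integral_PiM_pair_marginal[of "\<lambda>_. P" "{1..n}" b a, OF P _ ab(2,1) ab(3)[symmetric] this]
    show ?thesis by simp
  qed
  \<comment> \<open>The competing point \<open>x\<close> is moved innermost, so that centre and
    radius of its ball are fixed when it is integrated out.\<close>
  also have "\<dots> = (\<integral>\<^sup>+y. \<integral>\<^sup>+z. \<integral>\<^sup>+x. indicator ?S ((x, y), z) \<partial>P \<partial>Q \<partial>P)"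
    by (intro nn_integral_cong PQ.Fubini'[symmetric]) measurable
  also have "\<dots> \<le> (\<integral>\<^sup>+y. \<integral>\<^sup>+z. ennreal (B * unit_ball_vol DIM('a) * s ^ DIM('a)) * ennreal (norm z ^ DIM('a)) \<partial>Q \<partial>P)"
  proof (intro nn_integral_mono)
    fix y z
    have "(\<integral>\<^sup>+x. indicator ?S ((x, y), z) \<partial>P) = (\<integral>\<^sup>+x. indicator (cball (y + s *\<^sub>R z) (norm (s *\<^sub>R z))) x \<partial>P)"
      by (intro nn_integral_cong) (auto simp: indicator_def dist_commute)
    also have "\<dots> = emeasure P (cball (y + s *\<^sub>R z) (norm (s *\<^sub>R z)))"
      by (rule nn_integral_indicator) (simp add: sets_P)
    also have "\<dots> \<le> ennreal (B * unit_ball_vol DIM('a) * norm (s *\<^sub>R z) ^ DIM('a))"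
      by (rule emeasure_cball_le[OF p P_eq bound]) simp
    also have "\<dots> = ennreal (B * unit_ball_vol DIM('a) * s ^ DIM('a)) * ennreal (norm z ^ DIM('a))"
      using s by (subst ennreal_mult''[symmetric]) (simp_all add: power_mult_distrib ac_simps)
    finally show "(\<integral>\<^sup>+x. indicator ?S ((x, y), z) \<partial>P) \<le>
      ennreal (B * unit_ball_vol DIM('a) * s ^ DIM('a)) * ennreal (norm z ^ DIM('a))" .
  qed
  also have "\<dots> = ennreal (B * unit_ball_vol DIM('a) * s ^ DIM('a)) * (\<integral>\<^sup>+z. ennreal (norm z ^ DIM('a)) \<partial>Q)"
    by (simp add: nn_integral_cmult P.emeasure_space_1)
  finally show ?thesis .
qed

text \<open>The true point lies at distance |s Z i| from observation i, so a mismatch of the true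
  permutation puts another point in a ball of that radius. The bound for fixed \<pi> does not depend
  on \<pi>, hence survives the average; the 2 comes from comparing the minimiser with the true
  permutation.\<close>

lemma risk_nearest_matching_le:
  assumes p[measurable]: "p \<in> borel_measurable borel" and P_eq: "P = density lborel (\<lambda>x. ennreal (p x))"
    and bound: "\<And>x. p x \<le> B" and s: "0 \<le> s"
  shows "ennreal (risk P Q n s (nearest_matching n)) \<le>
    ennreal (2 * (real n)\<^sup>2) * (ennreal (B * unit_ball_vol DIM('a) * s ^ DIM('a)) * (\<integral>\<^sup>+z. ennreal (norm z ^ DIM('a)) \<partial>Q))"
    (is "_ \<le> _ * ?b")
proof -
  let ?I = "{1..n}"
  let ?S = "{w. dist (fst (fst w)) (snd (fst w) + s *\<^sub>R snd w) \<le> norm (s *\<^sub>R snd w)} :: (('a \<times> 'a) \<times> 'a) set"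
  interpret PZ: prob_space PZ by (intro prob_space_PiM Q)
  have S: "?S \<in> sets ((borel \<Otimes>\<^sub>M borel) \<Otimes>\<^sub>M borel)"
    unfolding borel_prod by (intro borel_closed closed_Collect_le continuous_intros)
  have comp: "(\<lambda>w. fst w k) \<in> borel_measurable (PX \<Otimes>\<^sub>M PZ)" "(\<lambda>w. snd w k) \<in> borel_measurable (PX \<Otimes>\<^sub>M PZ)"
    if "k \<in> ?I" for k
    using measurable_compose[OF measurable_fst measurable_component_singleton[OF that, of "\<lambda>_. P"]]
      measurable_compose[OF measurable_snd measurable_component_singleton[OF that, of "\<lambda>_. Q"]]
    by (simp_all add: measurable_cong_sets[OF refl sets_P] measurable_cong_sets[OF refl sets_Q])
  have ind: "(\<lambda>w. indicator ?S ((fst w j, fst w k), snd w i) :: ennreal) \<in> borel_measurable (PX \<Otimes>\<^sub>M PZ)"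
    if "j \<in> ?I" "k \<in> ?I" "i \<in> ?I" for j k i
  proof -
    note [measurable] = comp(1)[OF that(1)] comp(1)[OF that(2)] comp(2)[OF that(3)] S
    show ?thesis by measurable
  qed
  have "(\<integral>\<^sup>+X. \<integral>\<^sup>+Z. of_nat (hamming_dist n (nearest_matching n (X, noisy_obs n s X Z \<pi>)) \<pi>) \<partial>PZ \<partial>PX)
     \<le> ennreal (2 * (real n)\<^sup>2) * ?b" if \<pi>: "\<pi> \<in> perms n" for \<pi>
  proof -
    have \<pi>_in: "\<pi> i \<in> ?I" if "i \<in> ?I" for i
      using \<pi> that by (simp add: perms_iff permutes_in_image del: atLeastAtMost_iff)
    let ?h = "\<lambda>i j w. indicator ?S ((fst w j, fst w (\<pi> i)), snd w i) :: ennreal"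
    have h_meas: "?h i j \<in> borel_measurable (PX \<Otimes>\<^sub>M PZ)" if "i \<in> ?I" "j \<in> ?I - {\<pi> i}" for i j
      using that by (intro ind \<pi>_in) auto
    have "(\<integral>\<^sup>+X. \<integral>\<^sup>+Z. of_nat (hamming_dist n (nearest_matching n (X, noisy_obs n s X Z \<pi>)) \<pi>) \<partial>PZ \<partial>PX)
      \<le> (\<integral>\<^sup>+X. \<integral>\<^sup>+Z. 2 * (\<Sum>i\<in>?I. \<Sum>j\<in>?I - {\<pi> i}. ?h i j (X, Z)) \<partial>PZ \<partial>PX)"
    proof (intro nn_integral_mono)
      fix X Z :: "nat \<Rightarrow> 'a"
      let ?Y = "noisy_obs n s X Z \<pi>"
      have "of_nat (hamming_dist n (nearest_matching n (X, ?Y)) \<pi>) \<le> (2 * of_nat (card (mismatches n X ?Y \<pi>)) :: ennreal)"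
        using of_nat_mono[OF hamming_dist_nearest_matching[OF \<pi>, of X ?Y], where 'a = ennreal] by simp
      also have "of_nat (card (mismatches n X ?Y \<pi>)) = (\<Sum>i\<in>?I. indicator (mismatches n X ?Y \<pi>) i :: ennreal)"
        by (simp add: indicator_def sum.If_cases mismatches_def Int_def)
      also have "\<dots> \<le> (\<Sum>i\<in>?I. \<Sum>j\<in>?I - {\<pi> i}. ?h i j (X, Z))"
      proof (rule sum_mono)
        fix i assume i: "i \<in> ?I"
        show "indicator (mismatches n X ?Y \<pi>) i \<le> (\<Sum>j\<in>?I - {\<pi> i}. ?h i j (X, Z))"
        proof (cases "i \<in> mismatches n X ?Y \<pi>")
          case True
          then obtain j where j: "j \<in> ?I - {\<pi> i}" "dist (X j) (?Y i) \<le> dist (X (\<pi> i)) (?Y i)"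
            unfolding mismatches_def by blast
          have Y: "?Y i = X (\<pi> i) + s *\<^sub>R Z i"
            using i by (simp add: noisy_obs_def)
          have "dist (X j) (X (\<pi> i) + s *\<^sub>R Z i) \<le> norm (s *\<^sub>R Z i)"
            using j(2) unfolding Y by (simp add: dist_norm)
          then have "indicator (mismatches n X ?Y \<pi>) i = ?h i j (X, Z)"
            using True by (simp add: indicator_def)
          also have "\<dots> \<le> (\<Sum>j\<in>?I - {\<pi> i}. ?h i j (X, Z))"
            using j(1) by (intro member_le_sum[where f = "\<lambda>j. ?h i j (X, Z)"]) auto
          finally show ?thesis .
        qed simp
      qed
      finally show "of_nat (hamming_dist n (nearest_matching n (X, ?Y)) \<pi>) \<le>
        2 * (\<Sum>i\<in>?I. \<Sum>j\<in>?I - {\<pi> i}. ?h i j (X, Z))"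
        by (simp add: mult_left_mono)
    qed
    also have "\<dots> = (\<integral>\<^sup>+w. 2 * (\<Sum>i\<in>?I. \<Sum>j\<in>?I - {\<pi> i}. ?h i j w) \<partial>(PX \<Otimes>\<^sub>M PZ))"
      by (intro PZ.nn_integral_fst borel_measurable_times_ennreal borel_measurable_const borel_measurable_sum h_meas)
    also have "\<dots> = 2 * (\<integral>\<^sup>+w. (\<Sum>i\<in>?I. \<Sum>j\<in>?I - {\<pi> i}. ?h i j w) \<partial>(PX \<Otimes>\<^sub>M PZ))"
      by (intro nn_integral_cmult borel_measurable_sum h_meas)
    also have "(\<integral>\<^sup>+w. (\<Sum>i\<in>?I. \<Sum>j\<in>?I - {\<pi> i}. ?h i j w) \<partial>(PX \<Otimes>\<^sub>M PZ)) =
        (\<Sum>i\<in>?I. \<integral>\<^sup>+w. (\<Sum>j\<in>?I - {\<pi> i}. ?h i j w) \<partial>(PX \<Otimes>\<^sub>M PZ))"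
      by (intro nn_integral_sum borel_measurable_sum h_meas)
    also have "\<dots> = (\<Sum>i\<in>?I. \<Sum>j\<in>?I - {\<pi> i}. \<integral>\<^sup>+w. ?h i j w \<partial>(PX \<Otimes>\<^sub>M PZ))"
      by (intro sum.cong[OF refl] nn_integral_sum h_meas)
    also have "\<dots> = (\<Sum>i\<in>?I. \<Sum>j\<in>?I - {\<pi> i}. \<integral>\<^sup>+X. \<integral>\<^sup>+Z. ?h i j (X, Z) \<partial>PZ \<partial>PX)"
      by (intro sum.cong[OF refl] PZ.nn_integral_fst[symmetric] h_meas)
    also have "\<dots> \<le> (\<Sum>i\<in>?I. \<Sum>j\<in>?I - {\<pi> i}. ?b)"
    proof (intro sum_mono)
      fix i j assume i: "i \<in> ?I" and "j \<in> ?I - {\<pi> i}"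
      then have j: "j \<in> ?I" "\<pi> i \<noteq> j" by auto
      show "(\<integral>\<^sup>+X. \<integral>\<^sup>+Z. ?h i j (X, Z) \<partial>PZ \<partial>PX) \<le> ?b"
        using close_to_noisy_point_le[OF p P_eq bound s i \<pi>_in[OF i] j] by simp
    qed
    \<comment> \<open>The terms with j = \<pi> i are added to obtain exactly n^2 summands.\<close>
    also have "\<dots> \<le> (\<Sum>i\<in>?I. \<Sum>j\<in>?I. ?b)"
      by (rule sum_mono) (rule sum_mono2, auto)
    also have "2 * \<dots> = ennreal (2 * (real n)\<^sup>2) * ?b"
      by (simp add: ennreal_mult power2_eq_square ennreal_of_nat_eq_real_of_nat mult.assoc)
    finally show ?thesis by (simp add: mult_left_mono)
  qed
  then have "ennreal (risk P Q n s (nearest_matching n)) \<le> (\<Sum>\<pi>\<in>perms n. ennreal (1 / fact n) * (ennreal (2 * (real n)\<^sup>2) * ?b))"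
    unfolding ennreal_risk[OF nearest_matching_estimator] by (intro sum_mono mult_left_mono) auto
  also have "\<dots> = (of_nat (fact n) * ennreal (1 / fact n)) * (ennreal (2 * (real n)\<^sup>2) * ?b)"
    by (simp add: mult.assoc)
  also have "of_nat (fact n) * ennreal (1 / fact n) = 1"
    by (simp add: ennreal_of_nat_eq_real_of_nat ennreal_mult[symmetric])
  finally show ?thesis by simp
qed

end

subsection \<open>The order of the optimal risk\<close>

text \<open>Total mass one forces a point of positive density, and continuity keeps the density
  above half that value nearby. The radius is written 2 r to match its uses, which take two
  successive displacements of length at most r.\<close>

lemma continuous_density_pos_on_ball:
  fixes p :: "'a::euclidean_space \<Rightarrow> real"
  assumes "prob_space (density lborel (\<lambda>x. ennreal (p x)))" and p: "continuous_on UNIV p"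
  obtains x0 r \<delta> where "0 < r" "0 < \<delta>" "\<And>x. x \<in> cball x0 (2 * r) \<Longrightarrow> \<delta> \<le> p x"
proof -
  interpret prob_space "density lborel (\<lambda>x. ennreal (p x))" by fact
  have [measurable]: "p \<in> borel_measurable borel"
    using p by (rule borel_measurable_continuous_onI)
  have "\<exists>x. 0 < p x"
  proof (rule ccontr)
    assume "\<nexists>x. 0 < p x"
    then have "ennreal (p x) = 0" for x by (simp add: ennreal_neg not_less)
    then show False using emeasure_space_1 by (simp add: emeasure_density)
  qed
  then obtain x0 where x0: "0 < p x0" by blast
  have "continuous (at x0) p" using p by (simp add: continuous_on_eq_continuous_at)
  then obtain e where e: "0 < e" "\<And>x. dist x x0 < e \<Longrightarrow> dist (p x) (p x0) < p x0 / 2"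
    using x0 unfolding continuous_at_eps_delta by (metis half_gt_zero)
  show ?thesis
  \<comment> \<open>The closed ball then has radius e / 2 and fits inside the open ball of radius e
    provided by continuity.\<close>
  proof (rule that[of "e / 4" "p x0 / 2" x0])
    fix x assume "x \<in> cball x0 (2 * (e / 4))"
    then have "dist x x0 < e" using e(1) by (simp add: dist_commute)
    from e(2)[OF this] show "p x0 / 2 \<le> p x" unfolding dist_real_def by linarith
  qed (use e(1) x0 in auto)
qed

section \<open>Expected number of isolated pairs and the lower bound for every estimator\<close>

context shuffled_observations
begin

lemma card_isolated_pairs:
  "(of_nat (card (isolated_pairs n t X)) :: ennreal) =
    (\<Sum>p\<in>(SIGMA a:{1..n}. {1..n} - {a}). indicator (isolated_pairs n t X) p)"
proof -
  define J where "J = (SIGMA a:{1..n}. {1..n} - {a})"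
  have J: "finite J" "J \<inter> isolated_pairs n t X = isolated_pairs n t X"
    by (auto simp: J_def isolated_pairs_def)
  have "(\<Sum>p\<in>J. indicator (isolated_pairs n t X) p) = (\<Sum>p\<in>J \<inter> isolated_pairs n t X. 1 :: ennreal)"
    unfolding sum.inter_restrict[OF J(1)] by (simp add: indicator_def of_bool_def)
  then show ?thesis
    unfolding J(2) J_def[symmetric] by simp
qed

lemma isolated_pair_measurable_Sigma:
  assumes "p \<in> (SIGMA a:{1..n}. {1..n} - {a})"
  shows "(\<lambda>X. indicator (isolated_pairs n t X) p :: ennreal) \<in> borel_measurable PX"
proof -
  obtain a b where p: "p = (a, b)" by (cases p)
  show ?thesis
    unfolding p by (rule isolated_pair_measurable) (use assms p in auto)
qed

lemma card_isolated_pairs_measurable: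
  "(\<lambda>X. of_nat (card (isolated_pairs n t X)) :: ennreal) \<in> borel_measurable PX"
  unfolding card_isolated_pairs
  by (intro borel_measurable_sum isolated_pair_measurable_Sigma)

lemma expected_isolated_pairs_ge:
  assumes p: "p \<in> borel_measurable borel" and P_eq: "P = density lborel (\<lambda>x. ennreal (p x))"
    and bound: "\<And>x. p x \<le> B" and \<eta>: "0 \<le> \<eta>" "\<And>x. x \<in> cball x0 (2 * \<rho>) \<Longrightarrow> \<eta> \<le> p x"
    and t: "0 \<le> t" "t \<le> \<rho>" and small: "4 * real n * (B * unit_ball_vol DIM('a) * t ^ DIM('a)) \<le> 1"
    and n: "1 \<le> n"
  shows "ennreal (real n * (real n - 1) * (\<eta>\<^sup>2 * (unit_ball_vol DIM('a))\<^sup>2 * \<rho> ^ DIM('a) * t ^ DIM('a))) \<le>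
    2 * (\<integral>\<^sup>+X. of_nat (card (isolated_pairs n t X)) \<partial>PX)"
proof -
  let ?k = "\<eta>\<^sup>2 * (unit_ball_vol DIM('a))\<^sup>2 * \<rho> ^ DIM('a) * t ^ DIM('a)"
  let ?J = "SIGMA a:{1..n}. {1..n} - {a}"
  let ?g = "\<lambda>p X. indicator (isolated_pairs n t X) p :: ennreal"
  have card_J: "real (card ?J) = real n * (real n - 1)"
    using n by simp
  have "ennreal (real n * (real n - 1) * ?k) = of_nat (card ?J) * ennreal ?k"
    using \<eta>(1) t by (simp only: card_J[symmetric] ennreal_of_nat_eq_real_of_nat) (intro ennreal_mult; simp)
  also have "\<dots> = (\<Sum>p\<in>?J. ennreal ?k)" by simp
  also have "\<dots> \<le> (\<Sum>p\<in>?J. 2 * (\<integral>\<^sup>+X. ?g p X \<partial>PX))"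
  proof (rule sum_mono)
    fix x assume "x \<in> ?J"
    moreover obtain a b where x: "x = (a, b)" by (cases x)
    ultimately have ab: "a \<in> {1..n}" "b \<in> {1..n}" "a \<noteq> b" by auto
    show "ennreal ?k \<le> 2 * (\<integral>\<^sup>+X. ?g x X \<partial>PX)"
      unfolding x
      by (rule order_trans[OF close_pair_ge[OF p P_eq \<eta> t] isolated_pair_prob_ge[OF p P_eq bound t(1) small ab]])
  qed
  also have "\<dots> = 2 * (\<Sum>p\<in>?J. \<integral>\<^sup>+X. ?g p X \<partial>PX)"
    by (rule sum_distrib_left[symmetric])
  also have "(\<Sum>p\<in>?J. \<integral>\<^sup>+X. ?g p X \<partial>PX) = (\<integral>\<^sup>+X. of_nat (card (isolated_pairs n t X)) \<partial>PX)"
    unfolding card_isolated_pairs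
    by (intro nn_integral_sum[symmetric] isolated_pair_measurable_Sigma)
  finally show ?thesis .
qed

text \<open>The 4 is a product of two losses: a factor 2 because only half of the close pairs are
  guaranteed to be isolated, and a factor 2 from the exchange argument. The assumption t \<le> r * s
  lets that argument apply to every isolated pair.\<close>

lemma risk_ge:
  assumes p: "p \<in> borel_measurable borel" and P_eq: "P = density lborel (\<lambda>x. ennreal (p x))"
    and bound: "\<And>x. p x \<le> B" and \<eta>: "0 \<le> \<eta>" "\<And>x. x \<in> cball x0 (2 * \<rho>) \<Longrightarrow> \<eta> \<le> p x"
    and q: "q \<in> borel_measurable borel" and Q_eq: "Q = density lborel (\<lambda>x. ennreal (q x))"
    and \<delta>: "0 \<le> \<delta>" "\<And>z. z \<in> cball z0 (2 * r) \<Longrightarrow> \<delta> \<le> q z"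
    and s: "0 < s" and t: "0 \<le> t" "t \<le> \<rho>" "t \<le> r * s"
    and small: "4 * real n * (B * unit_ball_vol DIM('a) * t ^ DIM('a)) \<le> 1"
    and n: "1 \<le> n" and f: "f \<in> estimators n"
  shows "real n * (real n - 1) * (\<eta>\<^sup>2 * (unit_ball_vol DIM('a))\<^sup>2 * \<rho> ^ DIM('a) * t ^ DIM('a)) *
    (\<delta> * unit_ball_vol DIM('a) * r ^ DIM('a))\<^sup>2 \<le> 4 * risk P Q n s f"
proof -
  let ?e = "real n * (real n - 1) * (\<eta>\<^sup>2 * (unit_ball_vol DIM('a))\<^sup>2 * \<rho> ^ DIM('a) * t ^ DIM('a))"
  let ?\<kappa> = "(\<delta> * unit_ball_vol DIM('a) * r ^ DIM('a))\<^sup>2"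
  let ?G = "isolated_pairs n t"
  let ?A = "\<lambda>\<pi> X. \<integral>\<^sup>+Z. of_nat (hamming_dist n (f (X, noisy_obs n s X Z \<pi>)) \<pi>) \<partial>PZ"
  interpret PZ: prob_space PZ by (intro prob_space_PiM Q)
  have A_meas: "?A \<pi> \<in> borel_measurable PX" if "\<pi> \<in> perms n" for \<pi>
    using PZ.borel_measurable_nn_integral_fst[OF loss_measurable[OF f that]] by simp
  have e: "0 \<le> ?e" using n t by simp
  \<comment> \<open>The inequality is proved multiplied by n!, which clears the weight 1 / n! of
    each permutation and cancels at the end.\<close>
  have "ennreal (fact n * (?e * ?\<kappa>)) = ennreal ?e * (fact n * ennreal ?\<kappa>)"
  proof -
    have "(fact n :: ennreal) = ennreal (fact n)"
      by (metis ennreal_of_nat_eq_real_of_nat of_nat_fact)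
    moreover have "ennreal (fact n * (?e * ?\<kappa>)) = ennreal (fact n) * (ennreal ?e * ennreal ?\<kappa>)"
      by (simp only: ennreal_mult[OF _ mult_nonneg_nonneg[OF e zero_le_power2]] ennreal_mult[OF e zero_le_power2] fact_ge_zero)
    ultimately show ?thesis by (simp only: mult.left_commute)
  qed
  also have "\<dots> \<le> 2 * (\<integral>\<^sup>+X. of_nat (card (?G X)) \<partial>PX) * (fact n * ennreal ?\<kappa>)"
    by (intro mult_right_mono expected_isolated_pairs_ge[OF p P_eq bound \<eta> t(1,2) small n]) auto
  also have "\<dots> = 2 * ((\<integral>\<^sup>+X. of_nat (card (?G X)) \<partial>PX) * (fact n * ennreal ?\<kappa>))"
    by (rule mult.assoc)
  also have "\<dots> = 2 * (\<integral>\<^sup>+X. of_nat (card (?G X)) * (fact n * ennreal ?\<kappa>) \<partial>PX)"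
    by (subst nn_integral_multc[OF card_isolated_pairs_measurable]) (rule refl)
  also have "\<dots> \<le> 2 * (\<integral>\<^sup>+X. 2 * (\<Sum>\<pi>\<in>perms n. ?A \<pi> X) \<partial>PX)"
  proof (intro mult_left_mono nn_integral_mono)
    fix X assume X: "X \<in> space PX"
    show "of_nat (card (?G X)) * (fact n * ennreal ?\<kappa>) \<le> 2 * (\<Sum>\<pi>\<in>perms n. ?A \<pi> X)"
    proof (rule conditional_risk_lower_bound[where ?z0.0 = z0, OF Q_eq q s \<delta> X f])
      show "dist (X a) (X b) \<le> r * s" if "(a, b) \<in> ?G X" for a b
        using that t(3) by (auto simp: isolated_pairs_def)
    qed (assumption | rule isolated_pairs_subset single_valued_isolated_pairs sym_isolated_pairs
        irrefl_isolated_pairs)+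
  qed simp
  also have "\<dots> = 4 * (\<Sum>\<pi>\<in>perms n. \<integral>\<^sup>+X. ?A \<pi> X \<partial>PX)"
    using A_meas by (simp add: nn_integral_cmult nn_integral_sum mult.assoc[symmetric] del: One_nat_def)
  also have "(\<Sum>\<pi>\<in>perms n. \<integral>\<^sup>+X. ?A \<pi> X \<partial>PX) = ennreal (fact n * risk P Q n s f)"
  proof -
    have "ennreal (fact n * risk P Q n s f) = ennreal (fact n) * ennreal (risk P Q n s f)"
      by (simp add: ennreal_mult risk_nonneg)
    also have "\<dots> = (\<Sum>\<pi>\<in>perms n. (ennreal (fact n) * ennreal (1 / fact n)) * (\<integral>\<^sup>+X. ?A \<pi> X \<partial>PX))"
      unfolding ennreal_risk[OF f] sum_distrib_left mult.assoc ..
    also have "ennreal (fact n) * ennreal (1 / fact n) = 1"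
      by (simp add: ennreal_mult[symmetric])
    finally show ?thesis by simp
  qed
  also have "4 * ennreal (fact n * risk P Q n s f) = ennreal (fact n * (4 * risk P Q n s f))"
    using ennreal_mult[of 4 "fact n * risk P Q n s f"] by (simp add: risk_nonneg ac_simps)
  finally show ?thesis
    by (subst (asm) ennreal_le_iff) (simp_all add: risk_nonneg)
qed

end

text \<open>The constants are fixed before n and s, so the bounds are uniform in the noise level.
  The lower bound starts at n = 2: with one point there is one permutation and the risk is zero,
  while the rate is positive.\<close>

lemma optimal_risk_order:
  fixes P Q :: "'a::euclidean_space measure"
  assumes P: "prob_space P" and Q: "prob_space Q"
    and P_dens: "has_bounded_continuous_density P" and Q_dens: "has_bounded_continuous_density Q"
    and moment: "integrable Q (\<lambda>z. norm z ^ DIM('a))"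
  obtains c C where "0 < c" "0 < C"
    "\<And>n s. 2 \<le> n \<Longrightarrow> 0 < s \<Longrightarrow> c * min ((real n)\<^sup>2 * s ^ DIM('a)) (real n) \<le> optimal_risk P Q n s"
    "\<And>n s. 0 < s \<Longrightarrow> optimal_risk P Q n s \<le> C * min ((real n)\<^sup>2 * s ^ DIM('a)) (real n)"
proof -
  let ?d = "DIM('a)"
  let ?v = "unit_ball_vol (real ?d)"
  have v: "0 < ?v" by simp
  obtain p where p: "continuous_on UNIV p" "bounded (range p)" and P_eq: "P = density lborel (\<lambda>x. ennreal (p x))"
    using P_dens unfolding has_bounded_continuous_density_def by blast
  obtain q where q: "continuous_on UNIV q" and Q_eq: "Q = density lborel (\<lambda>x. ennreal (q x))"
    using Q_dens unfolding has_bounded_continuous_density_def by blast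
  have p_meas: "p \<in> borel_measurable borel" and q_meas: "q \<in> borel_measurable borel"
    using p(1) q by (auto intro: borel_measurable_continuous_onI)
  obtain B where B: "0 < B" "\<And>x. p x \<le> B"
    using p(2) unfolding bounded_pos by (force simp: abs_le_iff)
  obtain x0 \<rho> \<eta> where \<rho>: "0 < \<rho>" "0 < \<eta>" "\<And>x. x \<in> cball x0 (2 * \<rho>) \<Longrightarrow> \<eta> \<le> p x"
    using continuous_density_pos_on_ball[OF P[unfolded P_eq] p(1)] by metis
  obtain z0 r \<delta> where r: "0 < r" "0 < \<delta>" "\<And>x. x \<in> cball z0 (2 * r) \<Longrightarrow> \<delta> \<le> q x"
    using continuous_density_pos_on_ball[OF Q[unfolded Q_eq] q] by metis
  interpret shuffled_observations P Q n s for n s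
    by (rule shuffled_observations.intro[OF P Q]) (simp_all add: P_eq Q_eq)
  have bdd: "bdd_below (risk P Q n s ` estimators n)" for n s
    by (rule bdd_belowI2[where m = 0]) (rule risk_nonneg)
  define m where "m = (\<integral>z. norm z ^ ?d \<partial>Q)"
  have m: "0 \<le> m" "(\<integral>\<^sup>+z. ennreal (norm z ^ ?d) \<partial>Q) = ennreal m"
    unfolding m_def using moment by (auto intro: integral_nonneg_AE nn_integral_eq_integral)
  \<comment> \<open>\<beta> collects the two limits on t that do not involve s: t must stay below
    \<rho>, and 4 n B v t^d must be at most 1. Both hold once t^d is at most \<beta> / n.\<close>
  define \<beta> where "\<beta> = min (\<rho> ^ ?d) (1 / (4 * B * ?v))"
  have \<beta>: "0 < \<beta>" using \<rho>(1) B(1) v by (simp add: \<beta>_def)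
  \<comment> \<open>The 8 is the 4 of \<open>risk_ge\<close> times the 2 lost in n^2 \<le> 2 n (n -
    1), which holds for n at least 2.\<close>
  define k where "k = (\<eta>\<^sup>2 * ?v\<^sup>2 * \<rho> ^ ?d) * (\<delta> * ?v * r ^ ?d)\<^sup>2 / 8"
  have k: "0 < k"
    unfolding k_def by (intro divide_pos_pos mult_pos_pos zero_less_power \<rho>(1,2) r(1,2) v) simp
  show ?thesis
  \<comment> \<open>In the upper constant, the 1 serves the trivial bound n on the risk and the
    other term serves the nearest-neighbour bound.\<close>
  proof (rule that[of "k * min (r ^ ?d) \<beta>" "max 1 (2 * B * ?v * m)"])
    show "0 < k * min (r ^ ?d) \<beta>" "0 < max 1 (2 * B * ?v * m)"
      using k r(1) \<beta> by auto
  next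
    fix n :: nat and s :: real assume s: "0 < s"
    let ?f = "nearest_matching n :: (nat \<Rightarrow> 'a) \<times> (nat \<Rightarrow> 'a) \<Rightarrow> nat \<Rightarrow> nat"
    have opt: "optimal_risk P Q n s \<le> risk P Q n s ?f"
      unfolding optimal_risk_def by (rule cINF_lower[OF bdd nearest_matching_estimator])
    have "ennreal (risk P Q n s ?f) \<le> ennreal (2 * (real n)\<^sup>2) * (ennreal (B * ?v * s ^ ?d) * ennreal m)"
      using risk_nearest_matching_le[OF p_meas P_eq B(2), of s n] s unfolding m(2) by simp
    also have "\<dots> = ennreal (2 * B * ?v * m * ((real n)\<^sup>2 * s ^ ?d))"
      using B(1) s m(1) v by (simp add: ennreal_mult[symmetric] ac_simps)
    finally have "risk P Q n s ?f \<le> 2 * B * ?v * m * ((real n)\<^sup>2 * s ^ ?d)"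
      by (subst (asm) ennreal_le_iff) (use B(1) s m(1) v in auto)
    also have "\<dots> \<le> max 1 (2 * B * ?v * m) * ((real n)\<^sup>2 * s ^ ?d)"
      using s by (intro mult_right_mono) auto
    finally have 1: "risk P Q n s ?f \<le> max 1 (2 * B * ?v * m) * ((real n)\<^sup>2 * s ^ ?d)" .
    have "risk P Q n s ?f \<le> 1 * real n"
      using risk_le_card[OF nearest_matching_estimator] by simp
    also have "\<dots> \<le> max 1 (2 * B * ?v * m) * real n"
      by (intro mult_right_mono) auto
    finally show "optimal_risk P Q n s \<le> max 1 (2 * B * ?v * m) * min ((real n)\<^sup>2 * s ^ ?d) (real n)"
      using opt 1 by (auto simp: min_def)
  next
    fix n :: nat and s :: real assume n: "2 \<le> n" and s: "0 < s"
    \<comment> \<open>\<open>T\<close> is t^d for the isolation radius t: its first term gives t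
      \<le> r s, its second the limits held in \<beta>. Then n^2 \<open>T\<close> is the target rate
      up to the factors r^d and \<beta>.\<close>
    define T where "T = min (r ^ ?d * s ^ ?d) (\<beta> / n)"
    define t where "t = root ?d T"
    have T: "0 < T" using r(1) s \<beta> n by (simp add: T_def)
    then have t: "0 \<le> t" "t ^ ?d = T" by (simp_all add: t_def)
    have "t ^ ?d \<le> (r * s) ^ ?d"
      by (simp add: t(2) T_def power_mult_distrib)
    then have t_rs: "t \<le> r * s"
      using r(1) s by (subst (asm) power_mono_iff) (auto simp: t(1))
    have "\<beta> / n \<le> \<beta>" using n \<beta> by (simp add: field_simps)
    then have "t ^ ?d \<le> \<rho> ^ ?d"
      unfolding t(2) T_def \<beta>_def by linarith
    then have t_\<rho>: "t \<le> \<rho>"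
      using \<rho>(1) by (subst (asm) power_mono_iff) (auto simp: t(1))
    have "T \<le> 1 / (4 * B * ?v) / n"
      unfolding T_def \<beta>_def using n by (intro min.coboundedI2 divide_right_mono min.cobounded2) auto
    then have small: "4 * real n * (B * ?v * t ^ ?d) \<le> 1"
      using n B(1) v by (simp add: t(2) field_simps)
    have "risk P Q n s f \<ge> k * min (r ^ ?d) \<beta> * min ((real n)\<^sup>2 * s ^ ?d) (real n)" if f: "f \<in> estimators n" for f
    proof -
      have "min (r ^ ?d) \<beta> * min ((real n)\<^sup>2 * s ^ ?d) (real n) \<le> (real n)\<^sup>2 * T"
      proof -
        have "min (r ^ ?d) \<beta> * min ((real n)\<^sup>2 * s ^ ?d) (real n) \<le> r ^ ?d * ((real n)\<^sup>2 * s ^ ?d)"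
          using r(1) s \<beta> by (intro mult_mono) auto
        moreover have "min (r ^ ?d) \<beta> * min ((real n)\<^sup>2 * s ^ ?d) (real n) \<le> \<beta> * real n"
          using r(1) s \<beta> by (intro mult_mono) auto
        moreover have "(real n)\<^sup>2 * T = min (r ^ ?d * ((real n)\<^sup>2 * s ^ ?d)) (\<beta> * real n)"
          using n unfolding T_def min_mult_distrib_left by (simp add: power2_eq_square ac_simps)
        ultimately show ?thesis by simp
      qed
      then have "k * min (r ^ ?d) \<beta> * min ((real n)\<^sup>2 * s ^ ?d) (real n) \<le> k * ((real n)\<^sup>2 * T)"
        using k by (simp add: mult.assoc)
      also have "\<dots> \<le> k * (2 * (real n * (real n - 1)) * T)"
      proof (intro mult_left_mono mult_right_mono)
        have "real n * 2 \<le> real n * real n" using n by (intro mult_left_mono) auto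
        then show "(real n)\<^sup>2 \<le> 2 * (real n * (real n - 1))"
          by (simp add: power2_eq_square algebra_simps)
      qed (use T k in auto)
      also have "\<dots> = real n * (real n - 1) * (\<eta>\<^sup>2 * ?v\<^sup>2 * \<rho> ^ ?d * t ^ ?d) * (\<delta> * ?v * r ^ ?d)\<^sup>2 / 4"
        unfolding k_def t(2) by simp
      also have "\<dots> \<le> risk P Q n s f"
        using risk_ge[where ?x0.0 = x0 and ?z0.0 = z0, OF p_meas P_eq B(2) less_imp_le[OF \<rho>(2)] \<rho>(3) q_meas Q_eq less_imp_le[OF r(2)] r(3)
            s t(1) t_\<rho> t_rs small _ f] n by simp
      finally show ?thesis .
    qed
    then show "k * min (r ^ ?d) \<beta> * min ((real n)\<^sup>2 * s ^ ?d) (real n) \<le> optimal_risk P Q n s"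
      unfolding optimal_risk_def
      by (intro cINF_greatest) (use nearest_matching_estimator in blast)+
  qed
qed

theorem proposition2p2:
  fixes P Q :: "(real ^ 'd) measure"
  assumes "prob_space P" and "prob_space Q"
    and "has_bounded_continuous_density P" and "has_bounded_continuous_density Q"
    and "has_bochner_integral Q (\<lambda>z. z) 0"
    and "integrable Q (\<lambda>z. norm z ^ CARD('d))"
  shows "\<exists>c>0. \<exists>C>0. \<forall>\<sigma> :: nat \<Rightarrow> real. (\<forall>n. 0 < \<sigma> n) \<longrightarrow>
           (\<forall>\<^sub>F n in sequentially.
              c * min ((real n)\<^sup>2 * \<sigma> n ^ CARD('d)) (real n) \<le> optimal_risk P Q n (\<sigma> n) \<and>
              optimal_risk P Q n (\<sigma> n) \<le> C * min ((real n)\<^sup>2 * \<sigma> n ^ CARD('d)) (real n))"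
proof -
  have "integrable Q (\<lambda>z. norm z ^ DIM(real ^ 'd))"
    using assms(6) by simp
  from optimal_risk_order[OF assms(1-4) this]
  obtain c C where c: "0 < c" "0 < C"
    "\<And>n s. 2 \<le> n \<Longrightarrow> 0 < s \<Longrightarrow> c * min ((real n)\<^sup>2 * s ^ CARD('d)) (real n) \<le> optimal_risk P Q n s"
    "\<And>n s. 0 < s \<Longrightarrow> optimal_risk P Q n s \<le> C * min ((real n)\<^sup>2 * s ^ CARD('d)) (real n)"
    by (metis DIM_cart DIM_real mult.right_neutral)
  have "\<forall>\<^sub>F n in sequentially.
      c * min ((real n)\<^sup>2 * \<sigma> n ^ CARD('d)) (real n) \<le> optimal_risk P Q n (\<sigma> n) \<and>
      optimal_risk P Q n (\<sigma> n) \<le> C * min ((real n)\<^sup>2 * \<sigma> n ^ CARD('d)) (real n)"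
    if "\<forall>n. 0 < \<sigma> n" for \<sigma> :: "nat \<Rightarrow> real"
    \<comment> \<open>The threshold 2 does not depend on the noise sequence.\<close>
    using that c(3,4) by (intro eventually_sequentiallyI[of 2]) auto
  then show ?thesis
    using c(1,2) by blast
qed

end
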